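(* Let $E$ be a finite extension of $\mathbb{Q}_p$ and let $D\subset\mathbb{C}_p$ be a disk (open or closed) defined over $E$. Let $e$ be the smallest integer such that there exists a finite extension $F$ of $E$ with ramification index $e_{F/E}=e$ and $F\cap D\neq\emptyset$. Then $e=p^s$ for some integer $s\geq 0$, and there exists a finite extension $F$ of $E$ with $[F:E]\leq \max(1,p^{2s-1})$ such that $F\cap D\neq\emptyset$. Moreover, if $s\leq 1$, then every finite extension $F$ of $E$ with $[F:E]\leq\max(1,p^{2s-1})$ and $F\cap D\neq\emptyset$ is totally ramified over $E$.
   Context: A disk in $\mathbb{C}_p$ is a set $\{x\in\mathbb{C}_p : |x-a|\leq r\}$ (closed) or $\{x\in\mathbb{C}_p: |x-a|<r\}$ (open) for some $a\in\mathbb{C}_p$ and real $r>0$. Finite extensions of $\mathbb{Q}_p$ are taken inside $\bar{\mathbb{Q}}_p\subset\mathbb{C}_p$. The group $G_E=\operatorname{Gal}(\bar{\mathbb{Q}}_p/E)$ acts continuously on $\mathbb{C}_p$; a subset $D$ is defined over $E$ if $\sigma(D)=D$ for all $\sigma\in G_E$. *)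

theory Defs
  imports "HOL-Analysis.Analysis" "HOL-Algebra.Algebraic_Closure_Type"
begin

text \<open>
  The field of \<open>p\<close>-adic complex numbers is the completion of an algebraic closure of the
  completion of the rationals at \<open>p\<close>.  It is unique up to isometric isomorphism, and we let it be
  the universe of a type \<open>'c\<close> that is both a field and a complete metric space.
  The locale \<open>padic_complex\<close> below says that \<open>'c\<close> is such a field; since \<open>'c\<close> occurs only in its
  assumptions, the locale predicate takes the type as an extra first argument.
\<close>

abbreviation Cp :: "'c::field_char_0 ring"
  where "Cp \<equiv> ring_of_type_algebra"

definition absv :: "'c::{field_char_0,metric_space} \<Rightarrow> real"
  where "absv x = dist x 0"

text \<open>
  In a complete field the topological closure of the prime field is its completion.
\<close>

definition Qp :: "'c::{field_char_0,metric_space} set"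
  where "Qp = closure \<rat>"

definition Qp_bar :: "'c::{field_char_0,metric_space} set"
  where "Qp_bar = {x. (ring.algebraic Cp over Qp) x}"

text \<open>
  The value of \<open>p\<close> together with the ultrametric inequality forces the restriction of \<open>absv\<close> to
  the rationals to be the \<open>p\<close>-adic absolute value.
\<close>

locale padic_complex =
  fixes p :: nat
  assumes prime_p: "Factorial_Ring.prime p"
    and dist_absv: "\<And>x y::'c::{field_char_0,complete_space}. dist x y = absv (x - y)"
    and absv_mult: "\<And>x y::'c. absv (x * y) = absv x * absv y"
    and absv_ultrametric: "\<And>x y::'c. absv (x + y) \<le> max (absv x) (absv y)"
    and absv_p: "absv (of_nat p :: 'c) = 1 / real p"
    and alg_closure_Qp: "algebraic_closure (Cp\<lparr>carrier := Qp_bar :: 'c set\<rparr>) Qp"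
    and dense_Qp_bar: "closure (Qp_bar :: 'c set) = UNIV"

definition is_disk :: "'c::metric_space set \<Rightarrow> bool"
  where "is_disk D \<longleftrightarrow> (\<exists>a r. r > 0 \<and> (D = cball a r \<or> D = ball a r))"

definition is_finite_extension :: "'c::field_char_0 set \<Rightarrow> 'c set \<Rightarrow> bool"
  where "is_finite_extension E F \<longleftrightarrow>
    subfield E Cp \<and> subfield F Cp \<and> E \<subseteq> F \<and> ring.finite_dimension Cp E F"

lemma finite_extension_of_Qp_subset:
  assumes "is_finite_extension Qp F"
  shows "F \<subseteq> Qp_bar"
proof -
  interpret field "Cp :: 'a ring"
    by (rule field_from_type_algebra)
  show ?thesis
    using assms finite_dimension_imp_algebraic[OF _ subfieldE(1)]
    unfolding is_finite_extension_def Qp_bar_def by blast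
qed

definition ext_degree :: "'c::field_char_0 set \<Rightarrow> 'c set \<Rightarrow> nat"
  where "ext_degree E F = ring.dim Cp E F"

definition value_group :: "'c::{field_char_0,metric_space} set \<Rightarrow> real monoid"
  where "value_group K = \<lparr>carrier = absv ` (K - {0}), mult = (*), one = 1\<rparr>"

text \<open>
  The ramification index is the index of the value group of \<open>E\<close> in that of \<open>F\<close>.  It is at most
  the degree, so for finite extensions the set of cosets is finite.
\<close>

definition ramification_index :: "'c::{field_char_0,metric_space} set \<Rightarrow> 'c set \<Rightarrow> nat"
  where "ramification_index E F =
    card (rcosets\<^bsub>value_group F\<^esub> carrier (value_group E))"

definition totally_ramified :: "'c::{field_char_0,metric_space} set \<Rightarrow> 'c set \<Rightarrow> bool"
  where "totally_ramified E F \<longleftrightarrow> ramification_index E F = ext_degree E F"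

text \<open>
  Elements of the Galois group are functions on the whole type of which only the values on
  \<open>Qp_bar\<close> matter.
\<close>

definition galois_group :: "'c::{field_char_0,metric_space} set \<Rightarrow> ('c \<Rightarrow> 'c) set"
  where "galois_group E =
    {\<sigma> \<in> ring_iso (Cp\<lparr>carrier := Qp_bar\<rparr>) (Cp\<lparr>carrier := Qp_bar\<rparr>). \<forall>x\<in>E. \<sigma> x = x}"

text \<open>
  An automorphism of \<open>Qp_bar\<close> over \<open>Qp\<close> is an isometry, hence has a unique continuous extension to
  the completion; this is how the Galois group acts there.
\<close>

definition galois_action ::
    "('c \<Rightarrow> 'c) \<Rightarrow> 'c::{field_char_0,metric_space} \<Rightarrow> 'c"
  where "galois_action \<sigma> =
    (THE \<tau>. continuous_on UNIV \<tau> \<and> (\<forall>x\<in>Qp_bar. \<tau> x = \<sigma> x))"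

definition defined_over :: "'c::{field_char_0,metric_space} set \<Rightarrow> 'c set \<Rightarrow> bool"
  where "defined_over E D \<longleftrightarrow> (\<forall>\<sigma>\<in>galois_group E. galois_action \<sigma> ` D = D)"

end

theory Submission
  imports Defs "HOL-Algebra.Exponent"
begin

text \<open>
  Let \<open>n\<close> be the least degree over \<open>E\<close> of a point \<open>x\<close> of \<open>D\<close>. By an argument of Ax, \<open>n\<close> is a power
  of \<open>p\<close>. A polynomial \<open>f\<close> over \<open>E\<close> of degree less than \<open>n\<close> has no root in \<open>D\<close>, hence
  \<open>|f y - f x| < |f x|\<close> for all \<open>y\<close> in \<open>D\<close>. Since the values \<open>f x\<close> exhaust \<open>E(x)\<close>, this has two
  consequences. The value group of \<open>E(x)\<close> is contained in that of every \<open>F\<close> that meets \<open>D\<close>. And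
  a unit \<open>f x\<close> has the same residue \<open>c\<close> as all its conjugates, so that the norm of \<open>f x\<close> has residue
  \<open>c ^ n\<close>; as \<open>n\<close> is a power of \<open>p\<close> and the residue field of \<open>E\<close> is perfect, \<open>c\<close> lies in it.
  So \<open>E(x)\<close> has residue degree 1, its ramification index is \<open>n\<close>, and \<open>e = n\<close>. In particular
  the bound on the degree in the theorem can be improved to \<open>p ^ s\<close>.
\<close>

text \<open>The first estimate comes from factoring: a polynomial of degree less than
  \<open>n\<close> is a product of factors with zeros \<open>b\<close> outside \<open>D\<close>, and
  two points of \<open>D\<close> are closer to each other than to \<open>b\<close>. Each factor
  therefore changes by less than its own size, and so does the product. That \<open>D\<close> is
  defined over \<open>E\<close> serves to put all conjugates of \<open>x\<close> into
  \<open>D\<close>, for Ax's argument as well as for the norm. The residue degree never appears as a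
  number. Its being 1 is expressed by approximation: every unit of \<open>E(x)\<close> is at
  distance less than 1 from an element of \<open>E\<close>. Best approximation in a
  finite-dimensional space over \<open>E\<close> then takes the place of the identity between degree
  and the product of ramification index and residue degree. It exists because closed balls of
  \<open>E\<close> are compact; the same compactness makes the residue field perfect and
  automorphisms of \<open>Qp_bar\<close> isometric. The exponent \<open>2 s - 1\<close> matters only
  at the end. It is at least \<open>s\<close> for \<open>s >= 1\<close>, and for
  \<open>s <= 1\<close> the bound equals \<open>p ^ s\<close>, which squeezes the degree of
  \<open>F\<close> between two equal numbers.\<close>

hide_const (open) UnivPoly.up_ring.coeff UnivPoly.up_ring.monom Polynomials.lead_coeff
  Polynomials.degree Module.module.smult

section \<open>Polynomials over a subfield\<close>

lemma Cp_simps [simp]: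
  "carrier Cp = UNIV" "x \<otimes>\<^bsub>Cp\<^esub> y = x * y" "x \<oplus>\<^bsub>Cp\<^esub> y = x + y" "\<zero>\<^bsub>Cp\<^esub> = 0" "\<one>\<^bsub>Cp\<^esub> = 1"
  by (auto simp: ring_of_type_algebra_def)

lemma field_Cp: "field (Cp :: 'a::field_char_0 ring)"
  by (rule field_from_type_algebra)

lemma ring_Cp: "ring (Cp :: 'a::field_char_0 ring)"
  by (rule ring_from_type_algebra)

lemma a_inv_Cp [simp]: "\<ominus>\<^bsub>Cp\<^esub> x = - (x :: 'a::field_char_0)"
proof -
  interpret field "Cp :: 'a ring" by (rule field_Cp)
  show ?thesis
    using l_neg[of x] by (simp add: eq_neg_iff_add_eq_0)
qed

lemma nat_pow_Cp [simp]: "x [^]\<^bsub>Cp\<^esub> (n::nat) = (x :: 'a::field_char_0) ^ n"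
proof -
  interpret field "Cp :: 'a ring" by (rule field_Cp)
  show ?thesis by (induction n) (auto simp: mult.commute)
qed

text \<open>Trades the record operations for arithmetic of the type. Since
  \<open>inverse 0 = 0\<close>, closure under \<open>inverse\<close> needs no exception for
  zero.\<close>

lemma subfield_Cp_iff:
  fixes K :: "'a::field_char_0 set"
  shows "subfield K Cp \<longleftrightarrow> 0 \<in> K \<and> 1 \<in> K \<and> (\<forall>x\<in>K. \<forall>y\<in>K. x + y \<in> K) \<and> (\<forall>x\<in>K. - x \<in> K)
    \<and> (\<forall>x\<in>K. \<forall>y\<in>K. x * y \<in> K) \<and> (\<forall>x\<in>K. inverse x \<in> K)"  (is "?L \<longleftrightarrow> ?R")
proof
  interpret field "Cp :: 'a ring" by (rule field_Cp)
  assume L: ?L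
  have "inverse x \<in> K" if "x \<in> K" for x
  proof (cases "x = 0")
    case True
    then show ?thesis using that by simp
  next
    case False
    have "inv\<^bsub>Cp\<^esub> x \<in> K - {0}"
      using subfield_m_inv(1)[OF L, of x] that False by simp
    moreover have "x * inv\<^bsub>Cp\<^esub> x = 1"
      using subfield_m_inv(2)[OF L, of x] that False by simp
    then have "inv\<^bsub>Cp\<^esub> x = inverse x"
      using False by (simp add: inverse_unique)
    ultimately show ?thesis by simp
  qed
  then show ?R
    using subringE[OF subfieldE(1)[OF L]] by auto
next
  interpret field "Cp :: 'a ring" by (rule field_Cp)
  assume R: ?R
  show ?L
  proof (rule subfieldI')
    show "subring K Cp"
      by (rule subringI) (use R in auto)
    fix k :: 'a assume k: "k \<in> K - {\<zero>\<^bsub>Cp\<^esub>}"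
    then have "inv\<^bsub>Cp\<^esub> k = inverse k"
      by (intro comm_inv_char) auto
    then show "inv\<^bsub>Cp\<^esub> k \<in> K" using R k by simp
  qed
qed

locale Cp_subfield =
  fixes K :: "'a::field_char_0 set"
  assumes is_subfield: "subfield K Cp"
begin

lemma zero [simp]: "0 \<in> K" and one [simp]: "1 \<in> K"
  and add [intro]: "x \<in> K \<Longrightarrow> y \<in> K \<Longrightarrow> x + y \<in> K"
  and mult [intro]: "x \<in> K \<Longrightarrow> y \<in> K \<Longrightarrow> x * y \<in> K"
  and uminus [intro]: "x \<in> K \<Longrightarrow> - x \<in> K"
  and inv [intro]: "x \<in> K \<Longrightarrow> inverse x \<in> K"
  using is_subfield unfolding subfield_Cp_iff by auto

lemma diff [intro]: "x \<in> K \<Longrightarrow> y \<in> K \<Longrightarrow> x - y \<in> K"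
  using add[of x "- y"] by auto

lemma divide [intro]: "x \<in> K \<Longrightarrow> y \<in> K \<Longrightarrow> x / y \<in> K"
  using mult[of x "inverse y"] by (auto simp: divide_inverse)

lemma power [intro]: "x \<in> K \<Longrightarrow> x ^ n \<in> K"
  by (induction n) auto

lemma of_nat [intro]: "of_nat n \<in> K"
  by (induction n) auto

lemma sum [intro]: "(\<And>i. i \<in> A \<Longrightarrow> f i \<in> K) \<Longrightarrow> sum f A \<in> K"
  by (induction A rule: infinite_finite_induct) auto

end

text \<open>Polynomials keep coefficients in the whole type and membership in \<open>K\<close> is a
  side condition, so one polynomial can be viewed over several fields without conversion.\<close>

definition polys_over :: "'a::field_char_0 set \<Rightarrow> 'a poly set"
  where "polys_over K = {f. \<forall>i. coeff f i \<in> K}"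

lemma polys_over_mono: "K \<subseteq> L \<Longrightarrow> polys_over K \<subseteq> polys_over L"
  by (auto simp: polys_over_def)

text \<open>Least degree stands in for irreducibility, because it is what division with remainder
  exploits directly.\<close>

definition minpoly :: "'a::field_char_0 set \<Rightarrow> 'a \<Rightarrow> 'a poly \<Rightarrow> bool"
  where "minpoly K x m \<longleftrightarrow> m \<in> polys_over K \<and> lead_coeff m = 1 \<and> poly m x = 0 \<and>
    (\<forall>g\<in>polys_over K. g \<noteq> 0 \<and> poly g x = 0 \<longrightarrow> degree m \<le> degree g)"

lemma minpolyD:
  assumes "minpoly K x m"
  shows "m \<in> polys_over K" "lead_coeff m = 1" "poly m x = 0"
    "\<And>g. g \<in> polys_over K \<Longrightarrow> g \<noteq> 0 \<Longrightarrow> poly g x = 0 \<Longrightarrow> degree m \<le> degree g"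
    "m \<noteq> 0" "degree m > 0"
proof -
  show *: "m \<in> polys_over K" "lead_coeff m = 1" "poly m x = 0"
    "\<And>g. g \<in> polys_over K \<Longrightarrow> g \<noteq> 0 \<Longrightarrow> poly g x = 0 \<Longrightarrow> degree m \<le> degree g"
    using assms unfolding minpoly_def by auto
  show "m \<noteq> 0" using *(2) by auto
  show "degree m > 0"
  proof (rule ccontr)
    assume "\<not> degree m > 0"
    then obtain c where "m = [:c:]" by (metis degree_eq_zeroE not_gr0)
    then show False using * by auto
  qed
qed

definition adjoin :: "'a::field_char_0 set \<Rightarrow> 'a \<Rightarrow> 'a set"
  where "adjoin K x = (\<lambda>g. poly g x) ` polys_over K"

context Cp_subfield
begin

lemma coeff_in: "f \<in> polys_over K \<Longrightarrow> coeff f i \<in> K"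
  by (simp add: polys_over_def)

lemma polys_over_0 [simp]: "0 \<in> polys_over K"
  and polys_over_1 [simp]: "1 \<in> polys_over K"
  by (auto simp: polys_over_def coeff_1)

lemma polys_over_monom [intro]: "a \<in> K \<Longrightarrow> Polynomial.monom a n \<in> polys_over K"
  by (auto simp: polys_over_def)

lemma polys_over_pCons [simp]: "pCons a f \<in> polys_over K \<longleftrightarrow> a \<in> K \<and> f \<in> polys_over K"
  unfolding polys_over_def mem_Collect_eq by (metis coeff_pCons_0 coeff_pCons_Suc not0_implies_Suc)

lemma polys_over_add [intro]: "f \<in> polys_over K \<Longrightarrow> g \<in> polys_over K \<Longrightarrow> f + g \<in> polys_over K"
  by (auto simp: polys_over_def)

lemma polys_over_diff [intro]: "f \<in> polys_over K \<Longrightarrow> g \<in> polys_over K \<Longrightarrow> f - g \<in> polys_over K"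
  by (auto simp: polys_over_def)

lemma polys_over_uminus [intro]: "f \<in> polys_over K \<Longrightarrow> - f \<in> polys_over K"
  by (auto simp: polys_over_def)

lemma polys_over_mult [intro]: "f \<in> polys_over K \<Longrightarrow> g \<in> polys_over K \<Longrightarrow> f * g \<in> polys_over K"
  by (auto simp: polys_over_def coeff_mult)

lemma polys_over_smult [intro]: "a \<in> K \<Longrightarrow> f \<in> polys_over K \<Longrightarrow> smult a f \<in> polys_over K"
  by (auto simp: polys_over_def)

lemma poly_in [intro]: "f \<in> polys_over K \<Longrightarrow> x \<in> K \<Longrightarrow> poly f x \<in> K"
  by (auto simp: poly_altdef polys_over_def)

text \<open>The point is that quotient and remainder stay over \<open>K\<close>: each step cancels
  the leading term with a multiple of \<open>m\<close> whose factor has its coefficient in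
  \<open>K\<close>.\<close>

lemma polys_over_division:
  assumes "f \<in> polys_over K" "m \<in> polys_over K" "m \<noteq> 0"
  shows "\<exists>q\<in>polys_over K. \<exists>r\<in>polys_over K. f = q * m + r \<and> (r = 0 \<or> degree r < degree m)"
  using assms(1)
proof (induction "degree f" arbitrary: f rule: less_induct)
  case less
  show ?case
  proof (cases "f = 0 \<or> degree f < degree m")
    case True
    then show ?thesis
      using less.prems by (intro bexI[of _ 0] bexI[of _ f]) auto
  next
    case False
    define c where "c = Polynomial.monom (lead_coeff f / lead_coeff m) (degree f - degree m)"
    have c: "c \<in> polys_over K"
      unfolding c_def using less.prems assms(2) by (auto intro!: coeff_in)
    define g where "g = f - c * m"
    have g: "g \<in> polys_over K"
      unfolding g_def using less.prems c assms(2) by auto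
    have nz: "lead_coeff f / lead_coeff m \<noteq> 0" using False assms(3) by simp
    have c0: "c \<noteq> 0" using nz by (simp add: c_def)
    have dc: "degree (c * m) = degree f"
      using False assms(3) c0 nz by (simp add: degree_mult_eq) (simp add: c_def degree_monom_eq)
    have "coeff (c * m) (degree f) = lead_coeff f"
      using dc lead_coeff_mult[of c m] assms(3) nz by (simp add: c_def degree_monom_eq)
    then have lc: "coeff g (degree f) = 0" by (simp add: g_def)
    have dg: "degree g \<le> degree f" unfolding g_def by (rule degree_diff_le) (auto simp: dc)
    have "g = 0 \<or> degree g < degree f"
      using lc dg by (metis le_neq_implies_less leading_coeff_0_iff)
    then obtain q r where qr: "q \<in> polys_over K" "r \<in> polys_over K" "g = q * m + r"
      "r = 0 \<or> degree r < degree m"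
    proof
      assume "g = 0"
      then show ?thesis using that[of 0 0] by auto
    next
      assume "degree g < degree f"
      then show ?thesis using less.hyps[OF _ g] that by blast
    qed
    have "f = (c + q) * m + r" using qr(3) by (simp add: g_def algebra_simps)
    then show ?thesis using qr c by blast
  qed
qed

lemma polys_over_root_factor:
  assumes "f \<in> polys_over K" "x \<in> K" "poly f x = 0"
  shows "\<exists>q\<in>polys_over K. f = [:- x, 1:] * q"
proof -
  have "[:- x, 1:] \<in> polys_over K" using assms(2) by auto
  from polys_over_division[OF assms(1) this]
  obtain q r where q: "q \<in> polys_over K" and r: "f = q * [:- x, 1:] + r" "r = 0 \<or> degree r < 1"
    by auto
  from r(2) obtain c where c: "r = [:c:]" by (metis degree_eq_zeroE less_one degree_0)
  have "c = 0" using assms(3) r(1) c by simp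
  then show ?thesis using q r(1) c by (metis add.right_neutral mult.commute pCons_0_0)
qed

lemma minpoly_exists:
  assumes "f \<in> polys_over K" "f \<noteq> 0" "poly f x = 0"
  shows "\<exists>m. minpoly K x m"
proof -
  let ?P = "\<lambda>g. g \<in> polys_over K \<and> g \<noteq> 0 \<and> poly g x = 0"
  from exists_least_iff[of "\<lambda>n. \<exists>g. ?P g \<and> degree g = n"]
  obtain g where g: "?P g" and least: "\<And>h. ?P h \<Longrightarrow> degree g \<le> degree h"
    using assms by (metis not_le)
  define m where "m = smult (inverse (lead_coeff g)) g"
  have "minpoly K x m"
    unfolding minpoly_def m_def using g least by (auto intro: coeff_in)
  then show ?thesis ..
qed

lemma minpoly_dvd:
  assumes "minpoly K x m" "f \<in> polys_over K" "poly f x = 0"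
  shows "\<exists>q\<in>polys_over K. f = q * m"
proof -
  note m = minpolyD[OF assms(1)]
  from polys_over_division[OF assms(2) m(1,5)]
  obtain q r where q: "q \<in> polys_over K" "r \<in> polys_over K" "f = q * m + r"
    "r = 0 \<or> degree r < degree m" by auto
  have "poly r x = 0" using q(3) assms(3) m(3) by simp
  then have "r = 0" using m(4)[OF q(2)] q(4) by force
  then show ?thesis using q by auto
qed

lemma minpoly_reduce:
  assumes "minpoly K x m" "f \<in> polys_over K"
  shows "\<exists>r\<in>polys_over K. poly f x = poly r x \<and> degree r < degree m"
proof -
  note m = minpolyD[OF assms(1)]
  from polys_over_division[OF assms(2) m(1,5)]
  obtain q r where q: "q \<in> polys_over K" "r \<in> polys_over K" "f = q * m + r"
    "r = 0 \<or> degree r < degree m" by auto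
  then show ?thesis using m by (intro bexI[of _ r]) auto
qed

text \<open>Dividing \<open>m\<close> by \<open>g\<close> makes \<open>- poly q x * poly g x\<close>
  the value of a remainder of smaller degree, to which the induction applies. That value is nonzero
  because \<open>g\<close> is not constant, so \<open>q\<close> has smaller degree than
  \<open>m\<close> and cannot vanish at \<open>x\<close>.\<close>

lemma minpoly_inverse:
  assumes m: "minpoly K x m" and "g \<in> polys_over K" "poly g x \<noteq> 0"
  shows "\<exists>u\<in>polys_over K. poly u x * poly g x = 1"
proof -
  note mD = minpolyD[OF m]
  have main: "\<exists>u\<in>polys_over K. poly u x * poly g x = 1"
    if "g \<in> polys_over K" "poly g x \<noteq> 0" "degree g < degree m" for g
    using that
  proof (induction "degree g" arbitrary: g rule: less_induct)
    case less
    have g0: "g \<noteq> 0" using less.prems by auto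
    show ?case
    proof (cases "degree g = 0")
      case True
      then obtain c where c: "g = [:c:]" by (metis degree_eq_zeroE)
      then have "c \<in> K" "c \<noteq> 0" using coeff_in[OF less.prems(1), of 0] g0 by auto
      then show ?thesis using c by (intro bexI[of _ "[:inverse c:]"]) auto
    next
      case False
      from polys_over_division[OF mD(1) less.prems(1) g0]
      obtain q r where q: "q \<in> polys_over K" "r \<in> polys_over K" "m = q * g + r"
        "r = 0 \<or> degree r < degree g" by auto
      have rx: "poly r x = - poly q x * poly g x"
        using arg_cong[OF q(3), of "\<lambda>f. poly f x"] mD(3) by (simp add: eq_neg_iff_add_eq_0 add.commute)
      have dr: "degree r < degree g" using q(4) False by auto
      have q0: "q \<noteq> 0" using q(3) dr less.prems(3) by auto
      have "q * g = m - r" using q(3) by simp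
      then have "degree (q * g) = degree m"
        using degree_add_eq_left[of "- r" m] dr less.prems(3) by simp
      then have "degree q < degree m" using q0 g0 False by (simp add: degree_mult_eq)
      then have "poly q x \<noteq> 0" using mD(4)[OF q(1) q0] by force
      then have "poly r x \<noteq> 0" using rx less.prems(2) by simp
      from less.hyps[OF dr q(2) this] dr less.prems(3)
      obtain u where u: "u \<in> polys_over K" "poly u x * poly r x = 1" by auto
      have "poly (- (u * q)) x * poly g x = 1" using u(2) rx by (simp add: algebra_simps)
      then show ?thesis using u(1) q(1) by blast
    qed
  qed
  obtain r where "r \<in> polys_over K" "poly g x = poly r x" "degree r < degree m"
    using minpoly_reduce[OF m assms(2)] by auto
  then show ?thesis using main[of r] assms(3) by auto
qed

lemma adjoin_subfield:
  assumes "minpoly K x m"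
  shows "subfield (adjoin K x) Cp"
  unfolding subfield_Cp_iff
proof (intro conjI ballI)
  show "0 \<in> adjoin K x" "1 \<in> adjoin K x"
    unfolding adjoin_def by (rule image_eqI[of _ _ 0] image_eqI[of _ _ 1]; simp)+
  fix a assume "a \<in> adjoin K x"
  then obtain f where f: "f \<in> polys_over K" "a = poly f x" by (auto simp: adjoin_def)
  show "- a \<in> adjoin K x" unfolding adjoin_def
    using f by (intro image_eqI[of _ _ "- f"]) auto
  show "inverse a \<in> adjoin K x"
  proof (cases "a = 0")
    case True
    then show ?thesis using \<open>a \<in> adjoin K x\<close> by simp
  next
    case False
    with minpoly_inverse[OF assms f(1)] f(2)
    obtain u where u: "u \<in> polys_over K" "poly u x * a = 1" by auto
    then have "inverse a = poly u x" by (metis inverse_unique mult.commute)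
    then show ?thesis using u by (auto simp: adjoin_def)
  qed
  fix b assume "b \<in> adjoin K x"
  then obtain g where g: "g \<in> polys_over K" "b = poly g x" by (auto simp: adjoin_def)
  show "a + b \<in> adjoin K x" unfolding adjoin_def
    using f g by (intro image_eqI[of _ _ "f + g"]) auto
  show "a * b \<in> adjoin K x" unfolding adjoin_def
    using f g by (intro image_eqI[of _ _ "f * g"]) auto
qed

lemma subset_adjoin: "K \<subseteq> adjoin K x"
proof
  fix a assume "a \<in> K"
  then show "a \<in> adjoin K x"
    unfolding adjoin_def by (intro image_eqI[of _ _ "[:a:]"]) auto
qed

lemma self_in_adjoin: "x \<in> adjoin K x"
  unfolding adjoin_def by (intro image_eqI[of _ _ "[:0, 1:]"]) auto

end

section \<open>Linear spans and the degree of a simple extension\<close>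

lemma Span_Cp_simps [simp]:
  fixes K :: "'a::field_char_0 set"
  shows "ring.Span Cp K [] = {0}"
    "ring.Span Cp K (u # us) = {a * u + w | a w. a \<in> K \<and> w \<in> ring.Span Cp K us}"
proof -
  interpret ring "Cp :: 'a ring" by (rule ring_Cp)
  show "Span K [] = {0}" by simp
  show "Span K (u # us) = {a * u + w | a w. a \<in> K \<and> w \<in> Span K us}"
    using line_extension_mem_iff[of _ K u "Span K us"] by (fastforce simp: set_eq_iff)
qed

context Cp_subfield
begin

sublocale Cp: field "Cp :: 'a ring" by (rule field_Cp)

declare Cp.Span.simps [simp del]

lemma Span_add: "x \<in> Cp.Span K us \<Longrightarrow> y \<in> Cp.Span K us \<Longrightarrow> x + y \<in> Cp.Span K us"
  using subgroup.m_closed[OF Cp.Span_is_add_subgroup[OF is_subfield], of us] by simp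

lemma Span_mult: "a \<in> K \<Longrightarrow> y \<in> Cp.Span K us \<Longrightarrow> a * y \<in> Cp.Span K us"
  using Cp.Span_smult_closed[OF is_subfield, of us] by simp

lemma dimension_adjoin:
  assumes "minpoly K x m"
  shows "Cp.dimension (degree m) K (adjoin K x)"
proof -
  note m = minpolyD[OF assms]
  \<comment> \<open>The list \<open>x ^ (n - 1), ..., x, 1\<close>, highest power first because
    \<open>Span\<close> and \<open>independent\<close> recurse on the head.\<close>
  define pw where "pw n = rec_nat [] (\<lambda>i us. x ^ i # us) n" for n
  have pw [simp]: "pw 0 = []" "pw (Suc n) = x ^ n # pw n" for n by (auto simp: pw_def)
  have len: "length (pw n) = n" for n by (induction n) auto
  \<comment> \<open>Vanishing of coefficients from \<open>n\<close> on, rather than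
    \<open>degree g < n\<close>, also gives the right set for \<open>n = 0\<close>.\<close>
  have Sp: "Cp.Span K (pw n) = (\<lambda>g. poly g x) ` {g \<in> polys_over K. \<forall>i\<ge>n. coeff g i = 0}" for n
  proof (induction n)
    case 0
    have "{g \<in> polys_over K. \<forall>i. coeff g i = 0} = {0}" by (auto intro: poly_eqI)
    then show ?case by simp
  next
    case (Suc n)
    show ?case
    proof (intro equalityI subsetI)
      fix y assume "y \<in> Cp.Span K (pw (Suc n))"
      then obtain a g where ag: "a \<in> K" "g \<in> polys_over K" "\<forall>i\<ge>n. coeff g i = 0"
        "y = a * x ^ n + poly g x"
        using Suc by auto
      then show "y \<in> (\<lambda>g. poly g x) ` {g \<in> polys_over K. \<forall>i\<ge>Suc n. coeff g i = 0}"
        by (intro image_eqI[of _ _ "Polynomial.monom a n + g"]) (auto simp: poly_monom)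
    next
      fix y assume "y \<in> (\<lambda>g. poly g x) ` {g \<in> polys_over K. \<forall>i\<ge>Suc n. coeff g i = 0}"
      then obtain g where g: "g \<in> polys_over K" "\<forall>i\<ge>Suc n. coeff g i = 0" "y = poly g x" by auto
      define h where "h = g - Polynomial.monom (coeff g n) n"
      have "h \<in> {g \<in> polys_over K. \<forall>i\<ge>n. coeff g i = 0}"
        using g by (auto simp: h_def Suc_le_eq intro!: polys_over_diff polys_over_monom coeff_in)
      then have "poly h x \<in> Cp.Span K (pw n)" using Suc by auto
      moreover have "y = coeff g n * x ^ n + poly h x"
        by (simp add: h_def g(3) poly_monom)
      ultimately show "y \<in> Cp.Span K (pw (Suc n))" using coeff_in[OF g(1)] by auto
    qed
  qed
  have ind: "Cp.independent K (pw n)" if "n \<le> degree m" for n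
    using that
  proof (induction n)
    case (Suc n)
    have "x ^ n \<notin> Cp.Span K (pw n)"
    proof
      assume "x ^ n \<in> Cp.Span K (pw n)"
      then obtain g where g: "g \<in> polys_over K" "\<forall>i\<ge>n. coeff g i = 0" "x ^ n = poly g x"
        using Sp by auto
      define h where "h = Polynomial.monom 1 n - g"
      have h: "h \<in> polys_over K" "poly h x = 0"
        using g by (auto simp: h_def poly_monom intro!: polys_over_diff polys_over_monom)
      have "coeff h n = 1" using g(2) by (simp add: h_def)
      then have "h \<noteq> 0" by auto
      moreover have "degree h \<le> n"
        by (rule degree_le) (use g(2) in \<open>auto simp: h_def\<close>)
      ultimately show False using m(4)[OF h(1) _ h(2)] Suc.prems by auto
    qed
    then show ?case using Suc by (auto intro: Cp.li_Cons)
  qed auto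
  have "Cp.Span K (pw (degree m)) = adjoin K x"
  proof (intro equalityI subsetI)
    fix y assume "y \<in> adjoin K x"
    then obtain f where "f \<in> polys_over K" "y = poly f x" by (auto simp: adjoin_def)
    with minpoly_reduce[OF assms] obtain r where
      "r \<in> polys_over K" "y = poly r x" "degree r < degree m" by metis
    then show "y \<in> Cp.Span K (pw (degree m))" unfolding Sp
      by (auto simp: coeff_eq_0)
  qed (auto simp: Sp adjoin_def)
  from Cp.dimensionI[OF is_subfield ind[OF order_refl] this] show ?thesis by (simp add: len)
qed

lemma finite_extension_adjoin:
  assumes "minpoly K x m"
  shows "is_finite_extension K (adjoin K x)" "ext_degree K (adjoin K x) = degree m"
proof -
  note d = dimension_adjoin[OF assms]
  show "is_finite_extension K (adjoin K x)"
    unfolding is_finite_extension_def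
    using is_subfield adjoin_subfield[OF assms] subset_adjoin Cp.finite_dimensionI[OF d] by auto
  show "ext_degree K (adjoin K x) = degree m"
    using Cp.dimI[OF is_subfield d] by (simp add: ext_degree_def over_def)
qed

end

section \<open>Automorphisms of an algebraically closed field\<close>

text \<open>The lists behind \<open>eval\<close> begin with the leading coefficient, those behind
  \<open>Poly\<close> with the constant one; hence \<open>rev\<close>.\<close>

lemma eval_Cp: "ring.eval Cp xs x = poly (Poly (rev xs)) (x :: 'a::field_char_0)"
proof -
  interpret field "Cp :: 'a ring" by (rule field_Cp)
  have *: "poly (Poly (ys @ [a])) x = poly (Poly ys) x + a * x ^ length ys" for ys and a :: 'a
    by (induction ys) (auto simp: algebra_simps)
  show ?thesis by (induction xs) (auto simp: *)
qed

lemma algebraic_over_CpE: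
  fixes x :: "'a::field_char_0"
  assumes "subfield K Cp" "(ring.algebraic Cp over K) x"
  obtains f where "f \<in> polys_over K" "f \<noteq> 0" "poly f x = 0"
proof -
  interpret field "Cp :: 'a ring" by (rule field_Cp)
  interpret K: Cp_subfield K by (rule Cp_subfield.intro[OF assms(1)])
  obtain xs where xs: "xs \<in> carrier (univ_poly Cp K)" "xs \<noteq> []" "eval xs x = 0"
    using algebraicE[OF subfieldE(1)[OF assms(1)] _ assms(2)] by auto
  have pol: "set xs \<subseteq> K" "hd xs \<noteq> 0"
    using xs(1,2) by (auto simp: univ_poly_def polynomial_def)
  have "Poly (rev xs) \<in> polys_over K"
    using pol(1) by (auto simp: polys_over_def nth_default_def rev_nth)
  moreover have "Poly (rev xs) \<noteq> 0"
    using pol(2) xs(2) by (metis Poly_append_replicate_zero Poly_eq_0 append_is_Nil_conv hd_replicate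
        hd_rev last_replicate last_rev length_0_conv rev_is_Nil_conv rev_rev_ident replicate_0)
  ultimately show ?thesis using that xs(3) by (simp add: eval_Cp)
qed

text \<open>Lists of roots stand for multisets of roots.\<close>

lemma poly_prod_roots: "poly (\<Prod>a\<leftarrow>as. [:- a, 1:]) x = (\<Prod>a\<leftarrow>as. x - a)"
  for x :: "'a::comm_ring_1"
  by (induction as) (auto simp: algebra_simps)

lemma poly_prod_roots_eq_0_iff: "poly (\<Prod>a\<leftarrow>as. [:- a, 1:]) x = 0 \<longleftrightarrow> x \<in> set as"
  for x :: "'a::field"
  unfolding poly_prod_roots by (auto simp: prod_list_zero_iff)

lemma degree_prod_roots: "degree (\<Prod>a\<leftarrow>as. [:- a, 1:]) = length (as :: 'a::field list)"
proof -
  have *: "(\<Prod>a\<leftarrow>as. [:- a, 1:]) \<noteq> 0" for as :: "'a list"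
    by (auto simp: prod_list_zero_iff)
  show ?thesis
    by (induction as) (auto simp: degree_mult_eq * simp del: mult_pCons_left)
qed

text \<open>To be used for \<open>Qp_bar\<close>. The field is a set inside the type, so that its
  elements share arithmetic and metric with the completion.\<close>

locale Cp_algebraically_closed = Cp_subfield Q for Q :: "'a::field_char_0 set" +
  assumes has_root: "f \<in> polys_over Q \<Longrightarrow> degree f > 0 \<Longrightarrow> \<exists>x\<in>Q. poly f x = 0"
begin

lemma splits:
  assumes "f \<in> polys_over Q" "f \<noteq> 0"
  shows "\<exists>as. set as \<subseteq> Q \<and> f = smult (lead_coeff f) (\<Prod>a\<leftarrow>as. [:- a, 1:])"
  using assms
proof (induction "degree f" arbitrary: f)
  case 0
  then obtain c where "f = [:c:]" by (metis degree_eq_zeroE)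
  then show ?case by (intro exI[of _ "[]"]) auto
next
  case (Suc n)
  obtain x where x: "x \<in> Q" "poly f x = 0" using has_root[OF Suc.prems(1)] Suc.hyps(2) by auto
  obtain q where q: "q \<in> polys_over Q" "f = [:- x, 1:] * q"
    using polys_over_root_factor[OF Suc.prems(1) x] by auto
  have q0: "q \<noteq> 0" using q(2) Suc.prems by auto
  have "degree f = Suc (degree q)"
    unfolding q(2) by (subst degree_mult_eq) (use q0 in auto)
  moreover have lc: "lead_coeff f = lead_coeff q"
    unfolding q(2) lead_coeff_mult by simp
  ultimately obtain as where as: "set as \<subseteq> Q" "q = smult (lead_coeff q) (\<Prod>a\<leftarrow>as. [:- a, 1:])"
    using Suc.hyps(1)[OF _ q(1) q0] Suc.hyps(2) by (metis Suc_inject)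
  have "f = smult (lead_coeff f) (\<Prod>a\<leftarrow>(x # as). [:- a, 1:])"
    unfolding lc by (subst q(2), subst as(2)) (simp del: mult_pCons_left)
  then show ?case using x(1) as(1) by (intro exI[of _ "x # as"]) auto
qed

text \<open>
  The product is the resultant of the two polynomials. One Euclidean division exchanges their
  roles and lowers the degree.
\<close>

lemma prod_values_at_roots_in_subfield:
  assumes "subfield K Cp" "K \<subseteq> Q"
    and "set as \<subseteq> Q" "(\<Prod>a\<leftarrow>as. [:- a, 1:]) \<in> polys_over K" "g \<in> polys_over K"
  shows "(\<Prod>a\<leftarrow>as. poly g a) \<in> K"
  using assms(3-)
proof (induction "length as" arbitrary: as g rule: less_induct)
  case less
  interpret K: Cp_subfield K by (rule Cp_subfield.intro[OF assms(1)])
  define m where "m = (\<Prod>a\<leftarrow>as. [:- a, 1:])"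
  have m: "m \<in> polys_over K" "m \<noteq> 0" "degree m = length as"
    using less.prems(2) by (auto simp: m_def prod_list_zero_iff degree_prod_roots)
  obtain q r where q: "q \<in> polys_over K" "r \<in> polys_over K" "g = q * m + r"
    "r = 0 \<or> degree r < degree m"
    using K.polys_over_division[OF less.prems(3) m(1,2)] by auto
  have gr: "poly g a = poly r a" if "a \<in> set as" for a
    using that by (simp add: q(3) m_def poly_prod_roots_eq_0_iff)
  have eq: "(\<Prod>a\<leftarrow>as. poly g a) = (\<Prod>a\<leftarrow>as. poly r a)"
    using gr by (metis map_eq_conv)
  show ?case
  proof (cases "as = [] \<or> r = 0")
    case True
    then show ?thesis unfolding eq by (cases as) auto
  next
    case False
    have "r \<in> polys_over Q" using q(2) polys_over_mono[OF assms(2)] by auto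
    from splits[OF this] False obtain bs
      where bs: "set bs \<subseteq> Q" "r = smult (lead_coeff r) (\<Prod>a\<leftarrow>bs. [:- a, 1:])" by blast
    define c where "c = lead_coeff r"
    have c: "c \<in> K" "c \<noteq> 0" using q(2) False by (auto simp: c_def K.coeff_in)
    define h where "h = (\<Prod>a\<leftarrow>bs. [:- a, 1:])"
    have rh: "r = smult c h" using bs(2) by (simp add: c_def h_def)
    \<comment> \<open>Dividing by the leading coefficient keeps \<open>h\<close> over
      \<open>K\<close>; so the induction hypothesis applies to the roots of \<open>r\<close>, with
      \<open>m\<close> as the polynomial to be evaluated.\<close>
    have "h = smult (inverse c) r" using c by (simp add: rh)
    then have h: "h \<in> polys_over K" using c q(2) by auto
    have "length bs < length as"
      using q(4) False m(3) rh c by (simp add: h_def degree_prod_roots)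
    from less.hyps[OF this bs(1) h[unfolded h_def] m(1)]
    have IH: "(\<Prod>b\<leftarrow>bs. poly m b) \<in> K" .
    \<comment> \<open>Exchanging the two root lists in the double product of differences costs only
      a sign, which lies in \<open>K\<close>.\<close>
    have flip: "(\<Prod>b\<leftarrow>bs. a - b) = (- 1) ^ length bs * (\<Prod>b\<leftarrow>bs. b - a)" for a :: 'a
      by (induction bs) (auto simp: algebra_simps)
    have "(\<Prod>a\<leftarrow>as. \<Prod>b\<leftarrow>bs. a - b) = (- 1) ^ (length bs * length as) * (\<Prod>a\<leftarrow>as. \<Prod>b\<leftarrow>bs. b - a)"
      unfolding flip by (induction as) (auto simp: algebra_simps power_add)
    also have "(\<Prod>a\<leftarrow>as. \<Prod>b\<leftarrow>bs. b - a) = (\<Prod>b\<leftarrow>bs. \<Prod>a\<leftarrow>as. b - a)"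
    proof (induction as)
      case (Cons a as)
      have "(\<Prod>b\<leftarrow>bs. (b - a) * f b) = (\<Prod>b\<leftarrow>bs. b - a) * (\<Prod>b\<leftarrow>bs. f b)" for f
        by (induction bs) (auto simp: algebra_simps)
      then show ?case using Cons by simp
    qed (induction bs; simp)
    finally have "(\<Prod>a\<leftarrow>as. poly h a) = (- 1) ^ (length bs * length as) * (\<Prod>b\<leftarrow>bs. poly m b)"
      by (simp add: h_def m_def poly_prod_roots)
    moreover have "(\<Prod>a\<leftarrow>as. poly r a) = c ^ length as * (\<Prod>a\<leftarrow>as. poly h a)"
      unfolding rh by (induction as) (auto simp: algebra_simps)
    ultimately show ?thesis unfolding eq using IH c(1)
      by (auto intro!: K.mult K.power K.uminus)
  qed
qed

end

text \<open>A partial isomorphism between subfields, given as a relation: extending it is inclusion,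
  a chain is bounded by its union, and the inverse is the converse. The last condition makes the
  relation single-valued.\<close>

definition field_graph :: "('a::field_char_0 \<times> 'a) set \<Rightarrow> bool"
  where "field_graph S \<longleftrightarrow> (0, 0) \<in> S \<and> (1, 1) \<in> S \<and>
    (\<forall>a b c d. (a, b) \<in> S \<longrightarrow> (c, d) \<in> S \<longrightarrow> (a + c, b + d) \<in> S \<and> (a * c, b * d) \<in> S) \<and>
    (\<forall>a b. (a, b) \<in> S \<longrightarrow> (- a, - b) \<in> S \<and> (inverse a, inverse b) \<in> S) \<and>
    (\<forall>b. (0, b) \<in> S \<longrightarrow> b = 0)"

text \<open>The partial isomorphism acting on coefficients.\<close>

definition polys_rel :: "('a::field_char_0 \<times> 'a) set \<Rightarrow> ('a poly \<times> 'a poly) set"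
  where "polys_rel S = {(g, h). \<forall>i. (coeff g i, coeff h i) \<in> S}"

lemma field_graphD:
  assumes "field_graph S"
  shows "(0, 0) \<in> S" "(1, 1) \<in> S"
    "(a, b) \<in> S \<Longrightarrow> (c, d) \<in> S \<Longrightarrow> (a + c, b + d) \<in> S"
    "(a, b) \<in> S \<Longrightarrow> (c, d) \<in> S \<Longrightarrow> (a * c, b * d) \<in> S"
    "(a, b) \<in> S \<Longrightarrow> (- a, - b) \<in> S"
    "(a, b) \<in> S \<Longrightarrow> (inverse a, inverse b) \<in> S"
    "(0, b) \<in> S \<Longrightarrow> b = 0"
  using assms unfolding field_graph_def by blast+

lemma field_graph_Id_on:
  assumes "subfield K Cp"
  shows "field_graph (Id_on K)"
proof -
  interpret Cp_subfield K by (rule Cp_subfield.intro[OF assms])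
  show ?thesis unfolding field_graph_def by (auto intro: mult)
qed

lemma
  assumes "field_graph S"
  shows field_graph_inj_0: "(a, 0) \<in> S \<Longrightarrow> a = 0"
    and field_graph_fun: "(a, b) \<in> S \<Longrightarrow> (a, c) \<in> S \<Longrightarrow> b = c"
proof -
  note S = field_graphD[OF assms]
  show f: "(a, b) \<in> S \<Longrightarrow> (a, c) \<in> S \<Longrightarrow> b = c" for a b c
  proof -
    assume "(a, b) \<in> S" "(a, c) \<in> S"
    then have "(a + (- a), b + (- c)) \<in> S" by (intro S(3,5))
    then have "(0, b - c) \<in> S" by simp
    from S(7)[OF this] show "b = c" by simp
  qed
  assume a: "(a, 0) \<in> S"
  show "a = 0"
  proof (rule ccontr)
    assume "a \<noteq> 0"
    \<comment> \<open>As \<open>inverse 0 = 0\<close>, a nonzero \<open>a\<close> related to 0 would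
      relate 1 to 0.\<close>
    have "(a * inverse a, 0 * inverse 0) \<in> S" by (intro S(4,6) a)
    then have "(1, 0) \<in> S" using \<open>a \<noteq> 0\<close> by simp
    from f[OF S(2) this] show False by simp
  qed
qed

lemma field_graph_converse: "field_graph S \<Longrightarrow> field_graph (S\<inverse>)"
  unfolding field_graph_def[of "S\<inverse>"] converse_iff
  by (blast intro: field_graphD(1-6) field_graph_inj_0)

lemma field_graph_Domain:
  assumes "field_graph S"
  shows "subfield (Domain S) Cp"
  unfolding subfield_Cp_iff Domain_iff by (blast intro: field_graphD(1-6)[OF assms])

section \<open>Extension of a partial isomorphism by one algebraic element\<close>

context
  fixes S :: "('a::field_char_0 \<times> 'a) set"
  assumes S: "field_graph S"
begin

lemma polys_rel_pCons: "(pCons a g, pCons b h) \<in> polys_rel S \<longleftrightarrow> (a, b) \<in> S \<and> (g, h) \<in> polys_rel S"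
  unfolding polys_rel_def mem_Collect_eq split_conv
  by (metis coeff_pCons_0 coeff_pCons_Suc not0_implies_Suc)

lemma polys_rel_0: "(0, 0) \<in> polys_rel S"
  by (simp add: polys_rel_def field_graphD(1)[OF S])

lemma polys_rel_const: "(a, b) \<in> S \<Longrightarrow> ([:a:], [:b:]) \<in> polys_rel S"
  by (simp add: polys_rel_pCons polys_rel_0)

lemma polys_rel_closed:
  assumes "(g, h) \<in> polys_rel S" "(g', h') \<in> polys_rel S"
  shows "(g + g', h + h') \<in> polys_rel S" "(g * g', h * h') \<in> polys_rel S" "(- g, - h) \<in> polys_rel S"
proof -
  have sum: "(sum f A, sum f' A) \<in> S" if "\<And>i. i \<in> A \<Longrightarrow> (f i, f' i) \<in> S"
    for f f' :: "nat \<Rightarrow> 'a" and A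
    using that by (induction A rule: infinite_finite_induct) (auto intro: field_graphD(1,3)[OF S])
  show "(g * g', h * h') \<in> polys_rel S"
    using assms unfolding polys_rel_def by (auto simp: coeff_mult intro!: sum field_graphD(4)[OF S])
  show "(g + g', h + h') \<in> polys_rel S" "(- g, - h) \<in> polys_rel S"
    using assms unfolding polys_rel_def by (auto intro: field_graphD(3,5)[OF S])
qed

lemma polys_rel_partner:
  "g \<in> polys_over (Domain S) \<Longrightarrow> \<exists>h. (g, h) \<in> polys_rel S"
proof (induction g)
  case 0
  then show ?case using polys_rel_0 by auto
next
  case (pCons a g)
  interpret D: Cp_subfield "Domain S" by (rule Cp_subfield.intro[OF field_graph_Domain[OF S]])
  show ?case using pCons polys_rel_pCons by (simp add: Domain_iff) blast
qed

lemma polys_rel_Domain: "(g, h) \<in> polys_rel S \<Longrightarrow> g \<in> polys_over (Domain S)"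
  unfolding polys_rel_def polys_over_def by auto

lemma polys_rel_fun: "(g, h) \<in> polys_rel S \<Longrightarrow> (g, h') \<in> polys_rel S \<Longrightarrow> h = h'"
  using field_graph_fun[OF S] by (intro poly_eqI) (force simp: polys_rel_def)

text \<open>Sending \<open>g x\<close> to the transported polynomial at \<open>y\<close> is well
  defined: if \<open>g\<close> vanishes at \<open>x\<close> it is a multiple of \<open>m\<close>, so
  its partner is a multiple of \<open>m'\<close> and vanishes at \<open>y\<close>.\<close>

lemma field_graph_extend:
  assumes m: "minpoly (Domain S) x m" and mm': "(m, m') \<in> polys_rel S" and y: "poly m' y = 0"
  defines "S' \<equiv> {(poly g x, poly h y) | g h. (g, h) \<in> polys_rel S}"
  shows "field_graph S'" "S \<subseteq> S'" "(x, y) \<in> S'"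
proof -
  interpret D: Cp_subfield "Domain S" by (rule Cp_subfield.intro[OF field_graph_Domain[OF S]])
  have S'I: "(g, h) \<in> polys_rel S \<Longrightarrow> a = poly g x \<Longrightarrow> b = poly h y \<Longrightarrow> (a, b) \<in> S'" for g h a b
    unfolding S'_def by blast
  note one = field_graphD(2)[OF S]
  show "S \<subseteq> S'"
    using S'I[OF polys_rel_const] by auto
  have "([:0, 1:], [:0, 1:]) \<in> polys_rel S"
    unfolding polys_rel_pCons using polys_rel_0 field_graphD(1,2)[OF S] by simp
  then show "(x, y) \<in> S'" by (auto intro: S'I)
  have zero: "b = 0" if ob: "(0, b) \<in> S'" for b
  proof -
    obtain g h where gh: "(g, h) \<in> polys_rel S" "poly g x = 0" "b = poly h y"
      using ob unfolding S'_def by (auto dest: sym)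
    obtain q where q: "q \<in> polys_over (Domain S)" "g = q * m"
      using D.minpoly_dvd[OF m polys_rel_Domain[OF gh(1)] gh(2)] by auto
    obtain q' where "(q, q') \<in> polys_rel S" using polys_rel_partner[OF q(1)] by auto
    from polys_rel_closed(2)[OF this mm'] have "h = q' * m'"
      using polys_rel_fun gh(1) q(2) by blast
    then show ?thesis using gh(3) y by simp
  qed
  have add: "(a + c, b + d) \<in> S'" and mult: "(a * c, b * d) \<in> S'"
    if abcd: "(a, b) \<in> S'" "(c, d) \<in> S'" for a b c d
  proof -
    obtain g h g' h' where gh: "(g, h) \<in> polys_rel S" "a = poly g x" "b = poly h y"
      "(g', h') \<in> polys_rel S" "c = poly g' x" "d = poly h' y"
      using abcd unfolding S'_def by auto
    note cl = polys_rel_closed[OF gh(1,4)]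
    show "(a + c, b + d) \<in> S'" "(a * c, b * d) \<in> S'"
      using cl gh by (auto intro: S'I)
  qed
  have uminus: "(- a, - b) \<in> S'" if ab: "(a, b) \<in> S'" for a b
  proof -
    obtain g h where gh: "(g, h) \<in> polys_rel S" "a = poly g x" "b = poly h y"
      using ab unfolding S'_def by auto
    show ?thesis using polys_rel_closed(3)[OF gh(1,1)] gh(2,3) by (auto intro: S'I)
  qed
  have inv: "(inverse a, inverse b) \<in> S'" if ab: "(a, b) \<in> S'" for a b
  proof (cases "a = 0")
    case True
    then show ?thesis using zero[of b] ab by auto
  next
    case False
    obtain g h where gh: "(g, h) \<in> polys_rel S" "a = poly g x" "b = poly h y"
      using ab unfolding S'_def by auto
    obtain u where u: "u \<in> polys_over (Domain S)" "poly u x * a = 1"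
      using D.minpoly_inverse[OF m polys_rel_Domain[OF gh(1)]] gh(2) False by auto
    obtain u' where "(u, u') \<in> polys_rel S" using polys_rel_partner[OF u(1)] by auto
    then have uu': "(poly u x, poly u' y) \<in> S'" by (auto intro: S'I)
    \<comment> \<open>The relation contains a pair whose first entry is \<open>1 - 1\<close>, so the
      second entry vanishes by \<open>zero\<close>; this makes \<open>poly u' y\<close> the inverse
      of \<open>b\<close>.\<close>
    have "(poly u x * a + (- 1), poly u' y * b + (- 1)) \<in> S'"
      by (rule add[OF mult[OF uu' ab] uminus]) (use one \<open>S \<subseteq> S'\<close> in auto)
    then have "(0, poly u' y * b - 1) \<in> S'" by (simp add: u(2))
    from zero[OF this] have "poly u' y * b = 1" by simp
    then have "inverse b = poly u' y" "inverse a = poly u x"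
      using u(2) by (metis inverse_unique mult.commute)+
    then show ?thesis using uu' by simp
  qed
  show "field_graph S'"
    unfolding field_graph_def
  proof (intro conjI allI impI)
    show "(0, 0) \<in> S'" "(1, 1) \<in> S'"
      using one field_graphD(1)[OF S] \<open>S \<subseteq> S'\<close> by auto
  qed (fact zero add mult uminus inv)+
qed

end

context Cp_algebraically_closed
begin

lemma field_graph_extend_Domain:
  assumes S: "field_graph S" "S \<subseteq> Q \<times> Q" and x: "x \<in> Q"
    and f: "f \<in> polys_over (Domain S)" "f \<noteq> 0" "poly f x = 0"
  shows "\<exists>S'. field_graph S' \<and> S \<subseteq> S' \<and> S' \<subseteq> Q \<times> Q \<and> x \<in> Domain S'"
proof -
  interpret D: Cp_subfield "Domain S" by (rule Cp_subfield.intro[OF field_graph_Domain[OF S(1)]])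
  obtain m where m: "minpoly (Domain S) x m" using D.minpoly_exists[OF f] by auto
  note mD = minpolyD[OF m]
  obtain m' where m': "(m, m') \<in> polys_rel S" using polys_rel_partner[OF S(1) mD(1)] by auto
  have rel_Q: "g \<in> polys_over Q" "h \<in> polys_over Q" if "(g, h) \<in> polys_rel S" for g h
    using that S(2) unfolding polys_rel_def polys_over_def by auto
  \<comment> \<open>The top coefficient of \<open>m'\<close> is the image of 1; so \<open>m'\<close>
    is not constant and has a root to send \<open>x\<close> to.\<close>
  have "(1, coeff m' (degree m)) \<in> S"
    using m' mD(2) unfolding polys_rel_def by (metis (mono_tags, lifting) case_prodD mem_Collect_eq)
  then have "coeff m' (degree m) = 1"
    using field_graph_fun[OF S(1) _ field_graphD(2)[OF S(1)]] by blast
  then have "degree m' > 0" using mD(6) le_degree[of m' "degree m"] by simp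
  then obtain y where y: "y \<in> Q" "poly m' y = 0" using has_root rel_Q[OF m'] by auto
  note ext = field_graph_extend[OF S(1) m m' y(2)]
  show ?thesis
    by (rule exI, intro conjI, rule ext(1), rule ext(2), use rel_Q x y(1) in blast,
        use ext(3) in blast)
qed

text \<open>Zorn's lemma gives a maximal partial isomorphism over \<open>K\<close> taking
  \<open>x\<close> to \<open>y\<close>. Extending it once more shows that its domain is
  \<open>Q\<close>; extending its converse shows the same for its range.\<close>

lemma automorphism_exists:
  assumes K: "subfield K Cp" "K \<subseteq> Q"
    and algebraic: "\<And>x. x \<in> Q \<Longrightarrow> \<exists>f\<in>polys_over K. f \<noteq> 0 \<and> poly f x = 0"
    and m: "minpoly K x m" "x \<in> Q" and y: "y \<in> Q" "poly m y = 0"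
  obtains \<sigma> where "\<sigma> \<in> ring_iso (Cp\<lparr>carrier := Q\<rparr>) (Cp\<lparr>carrier := Q\<rparr>)"
    "\<And>a. a \<in> K \<Longrightarrow> \<sigma> a = a" "\<sigma> x = y"
proof -
  have DI: "Domain (Id_on K) = K" by auto
  have rel_Id: "(g, h) \<in> polys_rel (Id_on K) \<longleftrightarrow> g = h \<and> g \<in> polys_over K" for g h
    unfolding polys_rel_def polys_over_def poly_eq_iff by (auto simp: Id_on_iff)
  have mm: "(m, m) \<in> polys_rel (Id_on K)" using rel_Id minpolyD(1)[OF m(1)] by auto
  define S0 where "S0 = {(poly g x, poly h y) | g h. (g, h) \<in> polys_rel (Id_on K)}"
  note ext = field_graph_extend[OF field_graph_Id_on[OF K(1)], of x m m y, unfolded DI,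
      OF m(1) mm y(2), folded S0_def]
  have S0Q: "S0 \<subseteq> Q \<times> Q"
    using m(2) y(1) polys_over_mono[OF K(2)] by (auto simp: S0_def rel_Id)
  define FG where "FG = {S. field_graph S \<and> S \<subseteq> Q \<times> Q \<and> S0 \<subseteq> S}"
  have "\<exists>M\<in>FG. \<forall>T\<in>FG. M \<subseteq> T \<longrightarrow> T = M"
  proof (rule subset_Zorn_nonempty)
    show "FG \<noteq> {}" using ext(1) S0Q by (auto simp: FG_def)
    fix C assume C: "C \<noteq> {}" "subset.chain FG C"
    have sub: "S \<in> C \<Longrightarrow> field_graph S \<and> S \<subseteq> Q \<times> Q \<and> S0 \<subseteq> S" for S
      using C(2) by (auto simp: FG_def subset_chain_def)
    have two: "\<exists>S\<in>C. u \<in> S \<and> v \<in> S" if uv: "u \<in> \<Union>C" "v \<in> \<Union>C" for u v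
    proof -
      obtain U V where UV: "U \<in> C" "u \<in> U" "V \<in> C" "v \<in> V" using uv by auto
      then have "U \<subseteq> V \<or> V \<subseteq> U" using C(2) by (auto simp: subset_chain_def)
      then show ?thesis using UV by auto
    qed
    obtain S where S: "S \<in> C" using C(1) by auto
    have fgC: "T \<in> C \<Longrightarrow> field_graph T" for T using sub by simp
    have "field_graph (\<Union>C)"
      unfolding field_graph_def
    proof (intro conjI allI impI)
      show "(0, 0) \<in> \<Union>C" "(1, 1) \<in> \<Union>C"
        using field_graphD(1,2)[OF fgC[OF S]] S by auto
      show "b = 0" if "(0, b) \<in> \<Union>C" for b
        using that fgC field_graphD(7) by (metis UnionE)
      show "(- a, - b) \<in> \<Union>C" "(inverse a, inverse b) \<in> \<Union>C" if "(a, b) \<in> \<Union>C" for a b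
        using that fgC field_graphD(5,6) by (metis UnionE UnionI)+
      show "(a + c, b + d) \<in> \<Union>C" "(a * c, b * d) \<in> \<Union>C"
        if ab: "(a, b) \<in> \<Union>C" "(c, d) \<in> \<Union>C" for a b c d
      proof -
        from two[OF ab] obtain T where T: "T \<in> C" "(a, b) \<in> T" "(c, d) \<in> T" by auto
        then show "(a + c, b + d) \<in> \<Union>C" "(a * c, b * d) \<in> \<Union>C"
          using field_graphD(3,4)[OF fgC[OF T(1)] T(2,3)] by auto
      qed
    qed
    moreover have "\<Union>C \<subseteq> Q \<times> Q" "S0 \<subseteq> \<Union>C" using sub S by auto
    ultimately show "\<Union>C \<in> FG" by (simp add: FG_def)
  qed
  then obtain S where S: "S \<in> FG" "\<And>T. T \<in> FG \<Longrightarrow> S \<subseteq> T \<Longrightarrow> T = S" by auto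
  then have fg: "field_graph S" and SQ: "S \<subseteq> Q \<times> Q" and S0S: "S0 \<subseteq> S" by (auto simp: FG_def)
  have Id: "Id_on K \<subseteq> S" using ext(2) S0S by auto
  then have "K \<subseteq> Domain S" "K \<subseteq> Domain (S\<inverse>)" by auto
  note over = polys_over_mono[OF this(1)] polys_over_mono[OF this(2)]
  have Dom: "a \<in> Domain S" if aQ: "a \<in> Q" for a
  proof -
    obtain f where f: "f \<in> polys_over K" "f \<noteq> 0" "poly f a = 0" using algebraic \<open>a \<in> Q\<close> by blast
    obtain S' where "field_graph S'" "S \<subseteq> S'" "S' \<subseteq> Q \<times> Q" "a \<in> Domain S'"
      using field_graph_extend_Domain[OF fg SQ aQ _ f(2,3)] f(1) over(1) by blast
    then show ?thesis using S(2)[of S'] S0S by (auto simp: FG_def)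
  qed
  have Ran: "a \<in> Range S" if aQ: "a \<in> Q" for a
  proof -
    obtain f where f: "f \<in> polys_over K" "f \<noteq> 0" "poly f a = 0" using algebraic \<open>a \<in> Q\<close> by blast
    have "S\<inverse> \<subseteq> Q \<times> Q" using SQ by auto
    then obtain S' where S': "field_graph S'" "S\<inverse> \<subseteq> S'" "S' \<subseteq> Q \<times> Q" "a \<in> Domain S'"
      using field_graph_extend_Domain[OF field_graph_converse[OF fg] _ aQ _ f(2,3)] f(1) over(2)
      by blast
    have "S \<subseteq> S'\<inverse>" using S'(2) by auto
    then have "S'\<inverse> \<in> FG"
      using field_graph_converse[OF S'(1)] S'(3) S0S by (auto simp: FG_def)
    then have "S'\<inverse> = S" using S(2) \<open>S \<subseteq> S'\<inverse>\<close> by blast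
    then show ?thesis using S'(4) by auto
  qed
  define \<sigma> where "\<sigma> a = (THE b. (a, b) \<in> S)" for a
  have \<sigma>: "(a, b) \<in> S \<Longrightarrow> \<sigma> a = b" for a b
    unfolding \<sigma>_def using field_graph_fun[OF fg] by blast
  have \<sigma>S: "(a, \<sigma> a) \<in> S" if "a \<in> Q" for a
    using Dom[OF that] \<sigma> by auto
  note Sc = field_graphD[OF fg]
  have "\<sigma> \<in> ring_iso (Cp\<lparr>carrier := Q\<rparr>) (Cp\<lparr>carrier := Q\<rparr>)"
  proof (rule ring_iso_memI)
    fix a assume a: "a \<in> carrier (Cp\<lparr>carrier := Q\<rparr>)"
    then show "\<sigma> a \<in> carrier (Cp\<lparr>carrier := Q\<rparr>)" using \<sigma>S SQ by auto
    fix b assume b: "b \<in> carrier (Cp\<lparr>carrier := Q\<rparr>)"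
    have "(a + b, \<sigma> a + \<sigma> b) \<in> S" "(a * b, \<sigma> a * \<sigma> b) \<in> S" by (intro Sc(3,4) \<sigma>S; use a b in simp)+
    then show "\<sigma> (a \<otimes>\<^bsub>Cp\<lparr>carrier := Q\<rparr>\<^esub> b) = \<sigma> a \<otimes>\<^bsub>Cp\<lparr>carrier := Q\<rparr>\<^esub> \<sigma> b"
      "\<sigma> (a \<oplus>\<^bsub>Cp\<lparr>carrier := Q\<rparr>\<^esub> b) = \<sigma> a \<oplus>\<^bsub>Cp\<lparr>carrier := Q\<rparr>\<^esub> \<sigma> b"
      using \<sigma> by auto
  next
    show "\<sigma> \<one>\<^bsub>Cp\<lparr>carrier := Q\<rparr>\<^esub> = \<one>\<^bsub>Cp\<lparr>carrier := Q\<rparr>\<^esub>" using Sc(2) \<sigma> by auto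
  next
    have "inj_on \<sigma> Q"
    proof (rule inj_onI)
      fix a b assume "a \<in> Q" "b \<in> Q" "\<sigma> a = \<sigma> b"
      then show "a = b"
        using field_graph_fun[OF field_graph_converse[OF fg]] \<sigma>S by (metis converse_iff)
    qed
    moreover have "\<sigma> ` Q = Q"
    proof (intro equalityI subsetI)
      fix b assume "b \<in> Q"
      then obtain a where "(a, b) \<in> S" using Ran by auto
      then show "b \<in> \<sigma> ` Q" using \<sigma> SQ by blast
    qed (use \<sigma>S SQ in auto)
    ultimately show "bij_betw \<sigma> (carrier (Cp\<lparr>carrier := Q\<rparr>)) (carrier (Cp\<lparr>carrier := Q\<rparr>))"
      by (simp add: bij_betw_def)
  qed
  moreover have "\<sigma> a = a" if "a \<in> K" for a using Id \<sigma> that by auto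
  moreover have "\<sigma> x = y" using ext(3) S0S \<sigma> by auto
  ultimately show ?thesis using that by blast
qed

end

section \<open>The absolute value\<close>

text \<open>The Heine-Borel property. Balls about 0 suffice, because every ball lies in one of them;
  and unlike bare local compactness it forces \<open>V\<close> to be closed.\<close>

definition locally_compact_set :: "'a::{field_char_0,metric_space} set \<Rightarrow> bool"
  where "locally_compact_set V \<longleftrightarrow> (\<forall>r. compact (V \<inter> cball 0 r))"

context padic_complex
begin

lemma absv_0 [simp]: "absv (0::'c) = 0"
  by (simp add: absv_def)

lemma absv_nonneg [simp]: "absv (x::'c) \<ge> 0"
  by (simp add: absv_def)

lemma absv_eq_0_iff [simp]: "absv (x::'c) = 0 \<longleftrightarrow> x = 0"
  by (simp add: absv_def)

lemma absv_pos_iff [simp]: "absv (x::'c) > 0 \<longleftrightarrow> x \<noteq> 0"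
  by (simp add: absv_def)

lemma absv_1 [simp]: "absv (1::'c) = 1"
proof -
  have "absv (1::'c) * absv (1::'c) = absv (1::'c)" using absv_mult[of 1 1] by simp
  then show ?thesis by (metis absv_eq_0_iff mult_cancel_left2 zero_neq_one)
qed

lemma absv_minus_commute: "absv (x - y) = absv (y - x :: 'c)"
  by (metis dist_absv dist_commute)

lemma absv_minus [simp]: "absv (- x) = absv (x::'c)"
  using absv_minus_commute[of 0 x] by simp

lemma absv_inverse: "absv (inverse x) = inverse (absv (x::'c))"
proof (cases "x = 0")
  case False
  then have "absv x * absv (inverse x) = 1" by (simp flip: absv_mult)
  then show ?thesis by (simp add: inverse_unique)
qed simp

lemma absv_divide: "absv (x / y) = absv x / absv (y::'c)"
  by (simp add: divide_inverse absv_mult absv_inverse)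

lemma absv_power: "absv (x ^ n) = absv (x::'c) ^ n"
  by (induction n) (auto simp: absv_mult)

lemma absv_prod_list: "absv (prod_list xs) = prod_list (map absv (xs::'c list))"
  by (induction xs) (auto simp: absv_mult)

lemma absv_diff: "absv (x - y) \<le> max (absv x) (absv (y::'c))"
  using absv_ultrametric[of x "- y"] by simp

lemma absv_add_less: "absv x < r \<Longrightarrow> absv y < r \<Longrightarrow> absv (x + y :: 'c) < r"
  using absv_ultrametric[of x y] by auto

lemma absv_add_le: "absv x \<le> r \<Longrightarrow> absv y \<le> r \<Longrightarrow> absv (x + y :: 'c) \<le> r"
  using absv_ultrametric[of x y] by auto

lemma absv_diff_trans: "absv (x - y) < r \<Longrightarrow> absv (y - z) < r \<Longrightarrow> absv (x - z :: 'c) < r"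
  using absv_add_less[of "x - y" r "y - z"] by simp

lemma absv_add_eq: "absv x < absv y \<Longrightarrow> absv (x + y :: 'c) = absv y"
  using absv_ultrametric[of x y] absv_diff[of "x + y" x] by auto

lemma absv_eq_if_close: "absv (x - y) < absv y \<Longrightarrow> absv (x::'c) = absv y"
  using absv_add_eq[of "x - y" y] by simp

lemma absv_add_neq:
  assumes "absv x \<noteq> absv (y::'c)"
  shows "absv (x + y) = max (absv x) (absv y)"
  using assms absv_add_eq[of x y] absv_add_eq[of y x] by (cases "absv x < absv y") (auto simp: add.commute)

lemma absv_sum_le: "(\<And>i. i \<in> A \<Longrightarrow> absv (f i :: 'c) \<le> r) \<Longrightarrow> r \<ge> 0 \<Longrightarrow> absv (sum f A) \<le> r"
  by (induction A rule: infinite_finite_induct) (auto intro: absv_add_le)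

lemma dist_0_absv: "dist 0 (x::'c) = absv x"
  by (simp add: absv_def dist_commute)

section \<open>Absolute values of integers and rationals\<close>

lemma p_gt_1: "p > 1"
  using prime_p by (rule prime_gt_1_nat)

lemma absv_of_nat_le: "absv (of_nat n :: 'c) \<le> 1"
  by (induction n) (auto intro: absv_add_le)

lemma absv_of_int_le: "absv (of_int n :: 'c) \<le> 1"
  by (cases n) (auto simp: absv_of_nat_le simp del: of_nat_Suc)

text \<open>If \<open>n\<close> had absolute value less than 1, so would the combination
  \<open>u * n + v * p\<close>, which is 1 by Bezout.\<close>

lemma absv_of_int_eq_1:
  assumes "\<not> int p dvd n"
  shows "absv (of_int n :: 'c) = 1"
proof (rule ccontr)
  assume "absv (of_int n :: 'c) \<noteq> 1"
  then have n: "absv (of_int n :: 'c) < 1" using absv_of_int_le[of n] by linarith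
  have "coprime n (int p)"
    using assms prime_p by (metis coprime_commute prime_imp_coprime prime_nat_int_transfer)
  then obtain u v where uv: "u * n + v * int p = 1" using bezout_int[of n "int p"] by auto
  have "absv (of_int u * of_int n + of_int v * of_nat p :: 'c) < 1"
  proof (rule absv_add_less)
    show "absv (of_int u * of_int n :: 'c) < 1"
      using n mult_right_mono[OF absv_of_int_le[of u], of "absv (of_int n :: 'c)"]
      by (simp add: absv_mult)
    have "absv (of_int v :: 'c) * (1 / real p) \<le> 1 * (1 / real p)"
      using absv_of_int_le[of v] by (intro mult_right_mono) auto
    also have "\<dots> < 1" using p_gt_1 by simp
    finally show "absv (of_int v * of_nat p :: 'c) < 1" by (simp add: absv_mult absv_p)
  qed
  moreover have "of_int u * of_int n + of_int v * of_nat p = (1::'c)"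
    using arg_cong[OF uv, of "of_int :: int \<Rightarrow> 'c"] by simp
  ultimately show False by simp
qed

lemma absv_of_nat_eq_1:
  assumes "\<not> p dvd n"
  shows "absv (of_nat n :: 'c) = 1"
  using absv_of_int_eq_1[of "int n"] assms by simp

text \<open>Supplies the finite nets of the unit ball of \<open>Qp\<close>. In lowest terms the
  denominator \<open>b\<close> is prime to \<open>p\<close>, since otherwise the numerator would be
  prime to \<open>p\<close> and the fraction would exceed 1.\<close>

lemma rational_approx:
  assumes "x \<in> \<rat>" "absv (x::'c) \<le> 1"
  shows "\<exists>m<p ^ k. absv (x - of_nat m) \<le> 1 / real p ^ k"
proof -
  obtain r where "x = of_rat r" using assms(1) by (auto elim: Rats_cases)
  moreover obtain a b where ab: "quotient_of r = (a, b)" by fastforce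
  ultimately have x: "x = of_int a / of_int b" and cop: "coprime a b" and b: "b > 0"
    using quotient_of_div[OF ab] quotient_of_coprime[OF ab] quotient_of_denom_pos[OF ab]
    by (auto simp: of_rat_divide)
  have pb: "\<not> int p dvd b"
  proof
    assume pb: "int p dvd b"
    then have "\<not> int p dvd a"
      using cop prime_p p_gt_1 by (metis coprime_common_divisor not_prime_unit prime_nat_int_transfer)
    then have "absv (of_int a :: 'c) = 1" by (rule absv_of_int_eq_1)
    moreover obtain c where c: "b = int p * c" using pb by auto
    have "absv (of_int b :: 'c) = 1 / real p * absv (of_int c :: 'c)"
      unfolding c by (simp add: absv_mult absv_p)
    then have "absv (of_int b :: 'c) \<le> 1 / real p"
      using absv_of_int_le[of c] by (simp add: mult_left_le divide_right_mono)
    then have "absv (of_int b :: 'c) < 1" using p_gt_1 by (auto intro: order_le_less_trans)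
    moreover have "absv (of_int b :: 'c) > 0" using b by simp
    ultimately have "absv x > 1" by (simp add: x absv_divide)
    then show False using assms(2) by simp
  qed
  then have absb: "absv (of_int b :: 'c) = 1" by (rule absv_of_int_eq_1)
  have "coprime b (int p ^ k)"
    using pb prime_p by (metis coprime_commute coprime_power_right_iff prime_imp_coprime prime_nat_int_transfer)
  then obtain u v where uv: "u * b + v * int p ^ k = 1" using bezout_int[of b "int p ^ k"] by auto
  \<comment> \<open>By the Bezout relation \<open>u\<close> inverts \<open>b\<close> modulo
    \<open>p ^ k\<close>, so this is the residue of \<open>a / b\<close>.\<close>
  define m where "m = nat ((a * u) mod int p ^ k)"
  have pk: "int p ^ k > 0" using p_gt_1 by simp
  have m: "int m = (a * u) mod int p ^ k" using pk by (simp add: m_def)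
  then have "int m < int p ^ k" using pk by simp
  then have "m < p ^ k" by (metis of_nat_less_iff of_nat_power)
  moreover have "absv (x - of_nat m) \<le> 1 / real p ^ k"
  proof -
    obtain t where t: "a * u - int m = int p ^ k * t"
      unfolding m by (metis dvd_def mod_eq_dvd_iff mod_mod_trivial)
    have "of_int b * (x - of_nat m) = (of_int (a - b * int m) :: 'c)"
      using b by (simp add: x field_simps)
    also have "a - b * int m = int p ^ k * (a * v + b * t)"
    proof -
      have "a - b * int m = a * (u * b + v * int p ^ k) - b * int m" by (simp add: uv)
      also have "\<dots> = b * (a * u - int m) + a * v * int p ^ k" by (simp add: algebra_simps)
      finally show ?thesis unfolding t by (simp add: algebra_simps)
    qed
    finally have "of_int b * (x - of_nat m) = of_nat p ^ k * (of_int (a * v + b * t) :: 'c)" by simp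
    then have "absv (x - of_nat m) = (1 / real p) ^ k * absv (of_int (a * v + b * t) :: 'c)"
      using absb by (metis absv_mult absv_p absv_power mult_1)
    also have "\<dots> \<le> (1 / real p) ^ k"
      by (rule mult_left_le[OF absv_of_int_le]) simp
    finally show ?thesis by (simp add: power_one_over)
  qed
  ultimately show ?thesis by blast
qed

lemma ex_inverse_power_less: "e > 0 \<Longrightarrow> \<exists>k. 1 / real p ^ k < e"
  using real_arch_pow_inv[of e "1 / real p"] p_gt_1 by (auto simp: power_one_over)

text \<open>\<open>alg_closure_Qp\<close> speaks of the structure with carrier
  \<open>Qp_bar\<close>. Its negatives and its inverses of nonzero elements agree with those of the
  type, because their defining equations determine them.\<close>

lemma subfield_Qp_bar: "subfield (Qp_bar :: 'c set) Cp"
  and subfield_Qp: "subfield (Qp :: 'c set) Cp"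
  and Qp_subset: "(Qp :: 'c set) \<subseteq> Qp_bar"
proof -
  interpret L: algebraic_closure "Cp\<lparr>carrier := Qp_bar :: 'c set\<rparr>" Qp by (rule alg_closure_Qp)
  interpret Cp: field "Cp :: 'c ring" by (rule field_Cp)
  have minus: "\<ominus>\<^bsub>Cp\<lparr>carrier := Qp_bar\<rparr>\<^esub> x = - x" if "x \<in> Qp_bar" for x :: 'c
  proof -
    have "\<ominus>\<^bsub>Cp\<lparr>carrier := Qp_bar\<rparr>\<^esub> x + x = 0" using L.l_neg[of x] that by simp
    then show ?thesis by (simp add: eq_neg_iff_add_eq_0)
  qed
  have inv: "inv\<^bsub>Cp\<lparr>carrier := Qp_bar\<rparr>\<^esub> x = inverse x" "inverse x \<in> Qp_bar"
    if x: "x \<in> Qp_bar" "x \<noteq> 0" for x :: 'c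
  proof -
    have u: "x \<in> Units (Cp\<lparr>carrier := Qp_bar\<rparr>)" using x L.field_Units by simp
    have "x * inv\<^bsub>Cp\<lparr>carrier := Qp_bar\<rparr>\<^esub> x = 1" using L.Units_r_inv[OF u] by simp
    then show *: "inv\<^bsub>Cp\<lparr>carrier := Qp_bar\<rparr>\<^esub> x = inverse x" by (simp add: inverse_unique)
    show "inverse x \<in> Qp_bar" using L.Units_inv_closed[OF u] unfolding * by simp
  qed
  have closed: "0 \<in> (Qp_bar :: 'c set)" "1 \<in> (Qp_bar :: 'c set)"
    "\<And>x y :: 'c. x \<in> Qp_bar \<Longrightarrow> y \<in> Qp_bar \<Longrightarrow> x + y \<in> Qp_bar"
    "\<And>x y :: 'c. x \<in> Qp_bar \<Longrightarrow> y \<in> Qp_bar \<Longrightarrow> x * y \<in> Qp_bar"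
    using L.zero_closed L.add.m_closed monoid.one_closed[OF L.monoid_axioms]
      monoid.m_closed[OF L.monoid_axioms] by auto
  show "subfield (Qp_bar :: 'c set) Cp"
    unfolding subfield_Cp_iff
  proof (intro conjI ballI)
    fix x :: 'c assume x: "x \<in> Qp_bar"
    show "- x \<in> Qp_bar" using L.a_inv_closed[of x] minus[OF x] x by simp
    show "inverse x \<in> Qp_bar" using inv(2)[OF x] closed(1) by (cases "x = 0") auto
  qed (use closed in auto)
  have sub: "subfield Qp (Cp\<lparr>carrier := Qp_bar :: 'c set\<rparr>)"
    by (rule algebraic_closure.axioms(2)[OF alg_closure_Qp])
  note subr = subringE[OF subfieldE(1)[OF sub]]
  show "(Qp :: 'c set) \<subseteq> Qp_bar" using subr(1) by simp
  then have Qx: "x \<in> Qp \<Longrightarrow> x \<in> Qp_bar" for x :: 'c by auto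
  show "subfield (Qp :: 'c set) Cp"
    unfolding subfield_Cp_iff
  proof (intro conjI ballI)
    fix x :: 'c assume x: "x \<in> Qp"
    show "- x \<in> Qp" using subr(5)[of x] minus[OF Qx[OF x]] x by simp
    show "inverse x \<in> Qp"
      using L.subfield_m_inv(1)[OF sub, of x] inv(1)[OF Qx[OF x]] x by (cases "x = 0") auto
  qed (use subr in auto)
qed

end

section \<open>Local compactness\<close>

context padic_complex
begin

text \<open>The type classes of \<open>'c\<close> do not tie the metric to the arithmetic; only
  \<open>dist_absv\<close> does, so continuity is derived from the absolute value.\<close>

lemma continuous_on_affine:
  "continuous_on S (\<lambda>(a, w). a * u + w :: 'c)"
  unfolding continuous_on_iff
proof (intro ballI allI impI)
  fix x :: "'c \<times> 'c" and e :: real assume e: "e > 0"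
  obtain a w where x: "x = (a, w)" by fastforce
  \<comment> \<open>One bound for each summand of \<open>(b - a) * u + (v - w)\<close>; the
    \<open>+ 1\<close> covers \<open>u = 0\<close> and makes the estimate strict.\<close>
  define d where "d = min e (e / (absv u + 1))"
  have pos: "absv u + 1 > 0" using absv_nonneg[of u] by linarith
  then have d: "d > 0" using e by (simp add: d_def)
  have "dist (b * u + v) (a * u + w) < e" if bv: "dist (b, v) (a, w) < d" for b v
  proof -
    have b: "absv (b - a) < d" and v: "absv (v - w) < d"
      using bv dist_fst_le[of "(b, v)" "(a, w)"] dist_snd_le[of "(b, v)" "(a, w)"]
      by (auto simp flip: dist_absv)
    have "absv ((b - a) * u) \<le> d * absv u"
      unfolding absv_mult using b by (intro mult_right_mono) auto
    also have "\<dots> < d * (absv u + 1)" using d by simp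
    also have "\<dots> \<le> e / (absv u + 1) * (absv u + 1)"
      using pos by (intro mult_right_mono) (auto simp: d_def)
    also have "\<dots> = e" using pos by simp
    finally have "absv ((b - a) * u + (v - w)) < e"
      using v by (intro absv_add_less) (auto simp: d_def)
    then show ?thesis by (simp add: dist_absv algebra_simps)
  qed
  then show "\<exists>d>0. \<forall>x'\<in>S. dist x' x < d \<longrightarrow>
      dist (case x' of (a, w) \<Rightarrow> a * u + w) (case x of (a, w) \<Rightarrow> a * u + w) < e"
    using d by (intro exI[of _ d]) (auto simp: x)
qed

lemma continuous_on_mult_right: "continuous_on S (\<lambda>x. x * u :: 'c)"
proof -
  have "continuous_on S (\<lambda>x. (case (x, 0) of (a, w) \<Rightarrow> a * u + w))"
    by (rule continuous_on_compose2[OF continuous_on_affine[of UNIV u]]) (auto intro!: continuous_intros)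
  then show ?thesis by simp
qed

text \<open>A convergent sequence is bounded and so stays in one of the compact pieces.\<close>

lemma locally_compact_set_closed:
  assumes "locally_compact_set (V :: 'c set)"
  shows "closed V"
  unfolding closed_sequential_limits
proof (intro allI impI, elim conjE)
  fix f l assume f: "\<forall>n. f n \<in> V" "f \<longlonglongrightarrow> l"
  have "bounded (range f)" using f(2) convergent_imp_bounded by auto
  then obtain r where "\<forall>n. dist 0 (f n) \<le> r" unfolding bounded_any_center[of _ 0] by auto
  then have "\<forall>n. f n \<in> V \<inter> cball 0 r" using f(1) by auto
  moreover have "closed (V \<inter> cball 0 r)"
    using assms unfolding locally_compact_set_def by (simp add: compact_imp_closed)
  ultimately show "l \<in> V" using f(2) unfolding closed_sequential_limits by blast
qed

lemma compact_Qp_cball_1: "compact ((Qp :: 'c set) \<inter> cball 0 1)"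
  unfolding compact_eq_totally_bounded
proof (intro conjI allI impI)
  show "complete ((Qp :: 'c set) \<inter> cball 0 1)"
    unfolding complete_eq_closed Qp_def by auto
  fix e :: real assume e: "e > 0"
  obtain k where k: "1 / real p ^ k < e" using ex_inverse_power_less[OF e] by auto
  define T where "T = (of_nat ` {..<p ^ k} :: 'c set)"
  have "(Qp :: 'c set) \<inter> cball 0 1 \<subseteq> (\<Union>x\<in>T. ball x e)"
  proof
    fix x :: 'c assume x: "x \<in> Qp \<inter> cball 0 1"
    \<comment> \<open>The 1 keeps the approximating rational in the unit ball, where
      \<open>rational_approx\<close> applies.\<close>
    have "min e 1 > 0" using e by simp
    then obtain y where y: "y \<in> \<rat>" "dist y x < min e 1"
      using x unfolding Qp_def Int_iff closure_approachable by blast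
    have "absv (x + (y - x)) \<le> 1"
      by (rule absv_add_le) (use x y in \<open>auto simp: dist_0_absv simp flip: dist_absv\<close>)
    then obtain m where m: "m < p ^ k" "absv (y - of_nat m) \<le> 1 / real p ^ k"
      using rational_approx[OF y(1), of k] by auto
    have "absv (x - of_nat m) < e"
      by (rule absv_diff_trans[of x y]) (use m k y in \<open>auto simp: dist_commute simp flip: dist_absv\<close>)
    then have "x \<in> ball (of_nat m) e" by (simp add: dist_commute flip: dist_absv)
    then show "x \<in> (\<Union>x\<in>T. ball x e)" using m(1) by (auto simp: T_def)
  qed
  then show "\<exists>k. finite k \<and> (Qp :: 'c set) \<inter> cball 0 1 \<subseteq> (\<Union>x\<in>k. ball x e)"
    by (intro exI[of _ T]) (auto simp: T_def)
qed

text \<open>Division by a power of \<open>p\<close> stretches the unit ball over any given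
  ball.\<close>

lemma locally_compact_Qp: "locally_compact_set (Qp :: 'c set)"
  unfolding locally_compact_set_def
proof
  fix r :: real
  interpret Qp: Cp_subfield "Qp :: 'c set" by (rule Cp_subfield.intro[OF subfield_Qp])
  obtain N where N: "r < real p ^ N" using real_arch_pow[of "real p" r] p_gt_1 by auto
  have p0: "(of_nat p :: 'c) \<noteq> 0" using p_gt_1 by simp
  let ?A = "(\<lambda>x. x * inverse (of_nat p ^ N)) ` ((Qp :: 'c set) \<inter> cball 0 1)"
  have "(Qp :: 'c set) \<inter> cball 0 r = ?A \<inter> cball 0 r"
  proof (intro equalityI subsetI)
    fix x :: 'c assume x: "x \<in> Qp \<inter> cball 0 r"
    have "absv x * (1 / real p) ^ N \<le> real p ^ N * (1 / real p) ^ N"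
      using x N by (intro mult_right_mono) (auto simp: dist_0_absv)
    then have "absv (x * of_nat p ^ N) \<le> 1"
      using p_gt_1 by (simp add: absv_mult absv_power absv_p power_one_over)
    moreover have "x * of_nat p ^ N \<in> Qp" using x by (intro Qp.mult Qp.power Qp.of_nat) auto
    ultimately have "x \<in> ?A"
      using p0 by (intro image_eqI[of _ _ "x * of_nat p ^ N"]) (auto simp: dist_0_absv)
    then show "x \<in> ?A \<inter> cball 0 r" using x by auto
  qed (auto intro!: Qp.mult Qp.inv Qp.power Qp.of_nat)
  moreover have "compact ?A"
    by (rule compact_continuous_image[OF continuous_on_mult_right compact_Qp_cball_1])
  ultimately show "compact ((Qp :: 'c set) \<inter> cball 0 r)"
    by (simp add: compact_Int_closed)
qed

text \<open>A ball of radius \<open>\<delta>\<close> about \<open>u\<close> misses \<open>W\<close>,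
  and \<open>a * u + w\<close> is \<open>a\<close> times the difference of \<open>u\<close> and an
  element of \<open>W\<close>. Thus the size of a vector controls its coefficient at
  \<open>u\<close>, which is the inductive step in both results about spans below.\<close>

lemma outside_closed_subspace:
  assumes "closed (W :: 'c set)" "u \<notin> W" "subfield K Cp"
    and "\<And>a w. a \<in> K \<Longrightarrow> w \<in> W \<Longrightarrow> a * w \<in> W"
  shows "\<exists>\<delta>>0. \<forall>a\<in>K. \<forall>w\<in>W. absv a * \<delta> \<le> absv (a * u + w)"
proof -
  interpret K: Cp_subfield K by (rule Cp_subfield.intro[OF assms(3)])
  obtain \<delta> where \<delta>: "\<delta> > 0" "ball u \<delta> \<subseteq> - W"
    using assms(1,2) open_contains_ball[of "- W"] by auto
  have "absv a * \<delta> \<le> absv (a * u + w)" if aw: "a \<in> K" "w \<in> W" for a w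
  proof (cases "a = 0")
    case False
    have "- inverse a \<in> K" using aw(1) by (intro K.uminus K.inv)
    then have "- inverse a * w \<in> W" using aw(2) assms(4) by blast
    then have "- inverse a * w \<notin> ball u \<delta>" using \<delta>(2) by blast
    then have "\<delta> \<le> absv (u - - inverse a * w)"
      unfolding mem_ball dist_absv by simp
    then have "absv a * \<delta> \<le> absv (a * (u - - inverse a * w))"
      unfolding absv_mult by (intro mult_left_mono) auto
    also have "a * (u - - inverse a * w) = a * u + w" using False by (simp add: algebra_simps)
    finally show ?thesis .
  qed simp
  then show ?thesis using \<delta>(1) by auto
qed

lemma locally_compact_Span:
  assumes K: "subfield K Cp" and lc: "locally_compact_set (K :: 'c set)"
  shows "locally_compact_set (ring.Span Cp K us)"
proof -
  interpret K: Cp_subfield K by (rule Cp_subfield.intro[OF K])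
  show ?thesis
  proof (induction us)
    case Nil
    have "{0 :: 'c} \<inter> cball 0 r = (if r \<ge> 0 then {0} else {})" for r by auto
    then show ?case by (auto simp: locally_compact_set_def)
  next
    case (Cons u us)
    let ?W = "ring.Span Cp K us"
    let ?V = "ring.Span Cp K (u # us)"
    show ?case
    proof (cases "u \<in> ?W")
      case True
      have "?V = ?W"
      proof (intro equalityI subsetI)
        fix x assume "x \<in> ?V"
        then show "x \<in> ?W" using True K.Span_add K.Span_mult by auto
      next
        fix x assume "x \<in> ?W"
        then have "x = 0 * u + x" "x \<in> ?W" by auto
        then show "x \<in> ?V" unfolding Span_Cp_simps using K.zero by blast
      qed
      then show ?thesis using Cons by simp
    next
      case False
      obtain \<delta> where \<delta>: "\<delta> > 0" "\<And>a w. a \<in> K \<Longrightarrow> w \<in> ?W \<Longrightarrow> absv a * \<delta> \<le> absv (a * u + w)"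
        using outside_closed_subspace[OF locally_compact_set_closed[OF Cons] False K K.Span_mult] by blast
      have "compact (?V \<inter> cball 0 r)" for r
      proof -
        \<comment> \<open>Bounds \<open>w = x - a * u\<close> by the ultrametric inequality, so a
          ball of \<open>?V\<close> is covered by the image of a compact product.\<close>
        define R where "R = max r (r / \<delta> * absv u)"
        let ?B = "(\<lambda>(a, w). a * u + w) ` ((K \<inter> cball 0 (r / \<delta>)) \<times> (?W \<inter> cball 0 R))"
        have "?V \<inter> cball 0 r = ?B \<inter> cball 0 r"
        proof (intro equalityI subsetI)
          fix x assume x: "x \<in> ?V \<inter> cball 0 r"
          then obtain a w where aw: "a \<in> K" "w \<in> ?W" "x = a * u + w" by auto
          have "absv a * \<delta> \<le> r" using \<delta>(2)[OF aw(1,2)] x aw(3) by (simp add: dist_0_absv)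
          then have a: "absv a \<le> r / \<delta>" using \<delta>(1) by (simp add: field_simps)
          then have "absv (a * u) \<le> r / \<delta> * absv u"
            unfolding absv_mult by (intro mult_right_mono) auto
          then have "absv w \<le> R"
            using absv_diff[of x "a * u"] aw(3) x unfolding R_def by (auto simp: dist_0_absv)
          then show "x \<in> ?B \<inter> cball 0 r"
            using a aw x by (auto simp: dist_0_absv intro!: image_eqI[of _ _ "(a, w)"])
        qed auto
        moreover have "compact ?B"
          using lc Cons
          by (intro compact_continuous_image continuous_on_affine compact_Times)
             (auto simp: locally_compact_set_def)
        ultimately show ?thesis by (simp add: compact_Int_closed)
      qed
      then show ?thesis by (simp add: locally_compact_set_def)
    qed
  qed
qed

lemma finite_extension_Span:
  assumes "is_finite_extension K (F :: 'c set)"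
  obtains us where "F = ring.Span Cp K us"
proof -
  interpret K: Cp_subfield K
    using assms by (intro Cp_subfield.intro) (simp add: is_finite_extension_def)
  obtain n where "K.Cp.dimension n K F"
    using assms unfolding is_finite_extension_def K.Cp.finite_dimension_def by auto
  from K.Cp.exists_base[OF K.is_subfield this] that show ?thesis by auto
qed

lemma locally_compact_finite_extension:
  assumes "is_finite_extension Qp (F :: 'c set)"
  shows "locally_compact_set F"
  using finite_extension_Span[OF assms] locally_compact_Span[OF subfield_Qp locally_compact_Qp]
  by metis

text \<open>Meant for a Galois automorphism restricted to a finite extension of \<open>Qp\<close>.
  The component along \<open>u\<close> is controlled by \<open>outside_closed_subspace\<close>,
  hence so is the rest, to which the induction applies.\<close>

lemma linear_map_bounded:
  assumes K: "subfield K Cp" and lc: "locally_compact_set (K :: 'c set)"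
    and add: "\<And>x y. x \<in> ring.Span Cp K us \<Longrightarrow> y \<in> ring.Span Cp K us \<Longrightarrow> f (x + y) = f x + (f y :: 'c)"
    and mult: "\<And>a x. a \<in> K \<Longrightarrow> x \<in> ring.Span Cp K us \<Longrightarrow> f (a * x) = a * f x"
  shows "\<exists>C. \<forall>x\<in>ring.Span Cp K us. absv (f x) \<le> C * absv x"
proof -
  interpret K: Cp_subfield K by (rule Cp_subfield.intro[OF K])
  show ?thesis
    using add mult
  proof (induction us)
    case Nil
    have "f 0 = 0" using Nil(2)[of 0 0] by simp
    then show ?case by simp
  next
    case (Cons u us)
    let ?W = "ring.Span Cp K us"
    let ?V = "ring.Span Cp K (u # us)"
    have W0: "0 \<in> ?W" by (induction us) (auto intro: exI[of _ 0])
    have "x \<in> ?V" if "x \<in> ?W" for x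
    proof -
      have "x = 0 * u + x" "x \<in> ?W" using \<open>x \<in> ?W\<close> by auto
      then show "x \<in> ?V" unfolding Span_Cp_simps using K.zero by blast
    qed
    then have WV: "?W \<subseteq> ?V" by blast
    have IH: "\<exists>C. \<forall>x\<in>?W. absv (f x) \<le> C * absv x"
      by (rule Cons.IH) (use Cons.prems WV in blast)+
    show ?case
    proof (cases "u \<in> ?W")
      case True
      have "?V \<subseteq> ?W" using True K.Span_add K.Span_mult by auto
      then show ?thesis using IH by blast
    next
      case False
      obtain \<delta> where \<delta>: "\<delta> > 0" "\<And>a w. a \<in> K \<Longrightarrow> w \<in> ?W \<Longrightarrow> absv a * \<delta> \<le> absv (a * u + w)"
        using outside_closed_subspace[OF locally_compact_set_closed[OF locally_compact_Span[OF K lc]]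
            False K K.Span_mult] by blast
      obtain C0 where C0: "\<And>x. x \<in> ?W \<Longrightarrow> absv (f x) \<le> C0 * absv x" using IH by auto
      \<comment> \<open>\<open>C0\<close> may be negative when \<open>?W\<close> is the zero space;
        a nonnegative constant can multiply inequalities.\<close>
      define C where "C = max C0 0"
      have C: "absv (f x) \<le> C * absv x" if xW: "x \<in> ?W" for x
        using C0[OF xW] mult_right_mono[of C0 C "absv x"] by (simp add: C_def)
      \<comment> \<open>The first entry bounds the image of \<open>a * u\<close>, the second that of
        \<open>w\<close>.\<close>
      define M where "M = max (absv (f u) / \<delta>) (C * max 1 (absv u / \<delta>))"
      have C_nn: "C \<ge> 0" by (simp add: C_def)
      have "absv (f x) \<le> M * absv x" if xV: "x \<in> ?V" for x
      proof -
        obtain a w where aw: "a \<in> K" "w \<in> ?W" "x = a * u + w" using xV by auto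
        have "1 * u + 0 \<in> ?V" unfolding Span_Cp_simps using K.one W0 by blast
        then have uV: "u \<in> ?V" by simp
        have fx: "f x = a * f u + f w"
          unfolding aw(3) using Cons.prems(1)[of "a * u" w] Cons.prems(2)[OF aw(1) uV]
            K.Span_mult[OF aw(1) uV] WV aw(2) by auto
        have a: "absv a \<le> absv x / \<delta>" using \<delta>(2)[OF aw(1,2)] \<delta>(1) aw(3) by (simp add: field_simps)
        have 1: "absv (a * f u) \<le> M * absv x"
        proof -
          have "absv (a * f u) \<le> absv x / \<delta> * absv (f u)"
            unfolding absv_mult using a by (intro mult_right_mono) auto
          also have "\<dots> = absv (f u) / \<delta> * absv x" by simp
          also have "\<dots> \<le> M * absv x" by (intro mult_right_mono) (auto simp: M_def)
          finally show ?thesis .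
        qed
        have "absv (a * u) \<le> absv x / \<delta> * absv u"
          unfolding absv_mult using a by (intro mult_right_mono) auto
        also have "\<dots> = absv u / \<delta> * absv x" by simp
        also have "\<dots> \<le> max 1 (absv u / \<delta>) * absv x" by (intro mult_right_mono) auto
        finally have "absv (a * u) \<le> max 1 (absv u / \<delta>) * absv x" .
        moreover have "absv x \<le> max 1 (absv u / \<delta>) * absv x"
          using mult_right_mono[of 1 "max 1 (absv u / \<delta>)" "absv x"] by simp
        ultimately have "absv w \<le> max 1 (absv u / \<delta>) * absv x"
          using absv_diff[of x "a * u"] aw(3) by (simp add: max_def split: if_splits)
        then have "C * absv w \<le> C * (max 1 (absv u / \<delta>) * absv x)"
          using C_nn by (rule mult_left_mono)
        also have "\<dots> \<le> M * absv x"
          unfolding mult.assoc[symmetric] by (intro mult_right_mono) (auto simp: M_def)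
        finally have 2: "absv (f w) \<le> M * absv x" using C[OF aw(2)] by simp
        show ?thesis unfolding fx using 1 2 by (rule absv_add_le)
      qed
      then show ?thesis by blast
    qed
  qed
qed

end

section \<open>Residue fields and the Galois action\<close>

context padic_complex
begin

lemma absv_power_diff_less_1:
  assumes "absv (x :: 'c) \<le> 1" "absv y \<le> 1" "absv (x - y) < 1"
  shows "absv (x ^ n - y ^ n) < 1"
proof (induction n)
  case (Suc n)
  have "x ^ Suc n - y ^ Suc n = x * (x ^ n - y ^ n) + (x - y) * y ^ n" by (simp add: algebra_simps)
  moreover have "absv (x * (x ^ n - y ^ n)) < 1"
    using Suc assms(1) mult_right_mono[of "absv x" 1 "absv (x ^ n - y ^ n)"] by (simp add: absv_mult)
  moreover have "absv ((x - y) * y ^ n) < 1"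
    using assms(2,3) mult_left_mono[of "absv y ^ n" 1 "absv (x - y)"]
    by (simp add: absv_mult absv_power power_le_one)
  ultimately show ?case by (metis absv_add_less)
qed simp

text \<open>The inner binomial coefficients are divisible by \<open>p\<close>, so their terms have
  absolute value at most \<open>1 / p\<close>.\<close>

lemma frobenius_additive:
  assumes "absv (x :: 'c) \<le> 1" "absv y \<le> 1"
  shows "absv ((x + y) ^ p - x ^ p - y ^ p) < 1"
proof -
  have p: "p > 1" by (rule p_gt_1)
  have "(x + y) ^ p = (\<Sum>k\<le>p. of_nat (p choose k) * x ^ k * y ^ (p - k))" by (rule binomial_ring)
  also have "{..p} = insert 0 (insert p {1..<p})" using p by auto
  also have "(\<Sum>k\<in>\<dots>. of_nat (p choose k) * x ^ k * y ^ (p - k)) =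
      y ^ p + (x ^ p + (\<Sum>k=1..<p. of_nat (p choose k) * x ^ k * y ^ (p - k)))"
    using p by simp
  finally have "(x + y) ^ p - x ^ p - y ^ p = (\<Sum>k=1..<p. of_nat (p choose k) * x ^ k * y ^ (p - k))"
    by simp
  moreover have "absv (\<Sum>k=1..<p. of_nat (p choose k) * x ^ k * y ^ (p - k)) \<le> 1 / real p"
  proof (rule absv_sum_le)
    fix k assume k: "k \<in> {1..<p}"
    then have "p dvd (p choose k)" using prime_p by (intro dvd_choose_prime) auto
    then obtain c where c: "p choose k = p * c" by auto
    have "absv x ^ k * absv y ^ (p - k) \<le> 1"
      using assms by (intro mult_le_one power_le_one) auto
    then have "absv (of_nat c :: 'c) * (absv x ^ k * absv y ^ (p - k)) \<le> 1"
      by (intro mult_le_one[OF absv_of_nat_le]) simp_all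
    then have "1 / real p * (absv (of_nat c :: 'c) * (absv x ^ k * absv y ^ (p - k))) \<le> 1 / real p"
      by (intro mult_left_le) auto
    then show "absv (of_nat (p choose k) * x ^ k * y ^ (p - k)) \<le> 1 / real p"
      unfolding c by (simp add: absv_mult absv_power absv_p mult.assoc)
  qed simp
  moreover have "1 / real p < 1" using p by simp
  ultimately show ?thesis by (metis order_le_less_trans)
qed

lemma frobenius_inj:
  assumes "absv (x :: 'c) \<le> 1" "absv y \<le> 1" "absv (x ^ (p ^ j) - y ^ (p ^ j)) < 1"
  shows "absv (x - y) < 1"
  using assms
proof (induction j arbitrary: x y)
  case (Suc j)
  have "absv (x ^ p - y ^ p) < 1"
    by (rule Suc.IH) (use Suc.prems in \<open>simp_all add: absv_power power_le_one power_mult\<close>)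
  moreover have "absv (x - y) \<le> 1" using absv_diff[of x y] Suc.prems by auto
  \<comment> \<open>Additivity for \<open>x - y\<close> and \<open>y\<close>, rather than for
    \<open>x\<close> and \<open>- y\<close>, avoids the sign of \<open>(- y) ^ p\<close>, which
    depends on whether \<open>p\<close> is 2.\<close>
  then have "absv (x ^ p - (x - y) ^ p - y ^ p) < 1"
    using frobenius_additive[of "x - y" y] Suc.prems by simp
  ultimately have "absv ((x ^ p - y ^ p) + - (x ^ p - (x - y) ^ p - y ^ p)) < 1"
    by (intro absv_add_less) (simp_all del: minus_diff_eq)
  then have "absv ((x - y) ^ p) < 1" by simp
  then show "absv (x - y) < 1"
    using p_gt_1 by (simp add: absv_power power_less_one_iff)
qed simp

text \<open>Local compactness makes the residue field finite, so Frobenius has finite order on it.\<close>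

lemma frobenius_periodic:
  assumes K: "subfield K Cp" "locally_compact_set (K :: 'c set)" and a: "a \<in> K" "absv a \<le> 1"
  shows "\<exists>k>0. absv (a - a ^ (p ^ k)) < 1"
proof -
  interpret K: Cp_subfield K by (rule Cp_subfield.intro[OF K(1)])
  have "compact (K \<inter> cball 0 1)" using K(2) by (simp add: locally_compact_set_def)
  then obtain T where T: "finite T" "K \<inter> cball 0 1 \<subseteq> (\<Union>x\<in>T. ball x 1)"
    unfolding compact_eq_totally_bounded by (meson zero_less_one)
  have "\<exists>x\<in>T. absv (x - a ^ (p ^ i)) < 1" for i
  proof -
    have "a ^ (p ^ i) \<in> K \<inter> cball 0 1"
      using a by (auto simp: dist_0_absv absv_power power_le_one)
    then obtain x where "x \<in> T" "a ^ (p ^ i) \<in> ball x 1" using T(2) by blast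
    then show ?thesis unfolding mem_ball dist_absv by blast
  qed
  then obtain c where c: "\<And>i. c i \<in> T" "\<And>i. absv (c i - a ^ (p ^ i)) < 1" by metis
  \<comment> \<open>Pigeonhole: two iterates of Frobenius on \<open>a\<close> fall into the same
    ball of radius 1.\<close>
  have "finite (range c)" by (rule finite_subset[OF _ T(1)]) (use c(1) in blast)
  then have "\<not> inj c" using finite_imageD infinite_UNIV_nat by blast
  then obtain i j where "i \<noteq> j" "c i = c j" by (auto simp: inj_def)
  then obtain i j where ij: "i < j" "c i = c j" by (cases "i < j") (auto simp: not_less le_less)
  have "absv (a ^ (p ^ i) - a ^ (p ^ j)) < 1"
  proof (rule absv_diff_trans)
    show "absv (a ^ (p ^ i) - c i) < 1" using c(2)[of i] by (subst absv_minus_commute)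
    show "absv (c i - a ^ (p ^ j)) < 1" using c(2)[of j] unfolding ij(2) .
  qed
  also have "p ^ j = p ^ (j - i) * p ^ i" using ij(1) by (simp flip: power_add)
  finally have "absv (a ^ (p ^ i) - (a ^ (p ^ (j - i))) ^ (p ^ i)) < 1" by (simp add: power_mult)
  \<comment> \<open>Injectivity of Frobenius on residues cancels the common exponent
    \<open>p ^ i\<close>.\<close>
  then have "absv (a - a ^ (p ^ (j - i))) < 1"
    by (rule frobenius_inj[rotated 2]) (use a(2) in \<open>simp_all add: absv_power power_le_one\<close>)
  then show ?thesis using ij(1) by (intro exI[of _ "j - i"]) auto
qed

lemma residue_field_perfect:
  assumes K: "subfield K Cp" "locally_compact_set (K :: 'c set)" and a: "a \<in> K"
    and c: "absv c \<le> 1" "absv (c ^ (p ^ j) - a) < 1"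
  shows "\<exists>d\<in>K. absv (c - d) < 1"
proof -
  interpret K: Cp_subfield K by (rule Cp_subfield.intro[OF K(1)])
  have "absv (c ^ (p ^ j)) \<le> 1" using c(1) by (simp add: absv_power power_le_one)
  then have a1: "absv a \<le> 1" using absv_diff[of "c ^ (p ^ j)" "c ^ (p ^ j) - a"] c(2) by simp
  obtain k where k: "k > 0" "absv (a - a ^ (p ^ k)) < 1"
    using frobenius_periodic[OF K a a1] by auto
  have iter: "absv (a - a ^ (p ^ (k * t))) < 1" for t
  proof (induction t)
    case (Suc t)
    have "absv (a ^ (p ^ (k * t)) - (a ^ (p ^ k)) ^ (p ^ (k * t))) < 1"
      by (rule absv_power_diff_less_1) (use k a1 in \<open>auto simp: absv_power power_le_one\<close>)
    from absv_diff_trans[OF Suc this] show ?case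
      by (simp add: power_add algebra_simps flip: power_mult)
  qed simp
  \<comment> \<open>Applying Frobenius \<open>k * j\<close> times fixes the residue of
    \<open>a\<close>; stopping \<open>j\<close> steps early gives its \<open>p ^ j\<close>-th root
    inside \<open>K\<close>.\<close>
  define d where "d = a ^ (p ^ (k * j - j))"
  have "k * j - j + j = k * j" using k(1) by (cases k) auto
  then have "d ^ (p ^ j) = a ^ (p ^ (k * j))"
    unfolding d_def by (metis power_add power_mult)
  then have "absv (c ^ (p ^ j) - d ^ (p ^ j)) < 1"
    using absv_diff_trans[OF c(2) iter[of j]] by simp
  then have "absv (c - d) < 1"
    by (rule frobenius_inj[rotated 2]) (use a1 c in \<open>auto simp: d_def absv_power power_le_one\<close>)
  moreover have "d \<in> K" unfolding d_def by (rule K.power[OF a])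
  ultimately show ?thesis by blast
qed

section \<open>Automorphisms of \<open>Qp_bar\<close> and their action on the completion\<close>

lemma algebraically_closed_Qp_bar: "Cp_algebraically_closed (Qp_bar :: 'c set)"
proof -
  interpret Q: Cp_subfield "Qp_bar :: 'c set" by (rule Cp_subfield.intro[OF subfield_Qp_bar])
  interpret L: algebraic_closure "Cp\<lparr>carrier := Qp_bar :: 'c set\<rparr>" Qp by (rule alg_closure_Qp)
  show ?thesis
  proof (intro Cp_algebraically_closed.intro Cp_subfield.intro Cp_algebraically_closed_axioms.intro
      subfield_Qp_bar)
    fix f :: "'c poly" assume f: "f \<in> polys_over Qp_bar" "degree f > 0"
    define xs where "xs = rev (coeffs f)"
    have f0: "f \<noteq> 0" using f(2) by auto
    have nonempty: "xs \<noteq> []" using f0 by (simp add: xs_def)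
    have len: "length xs - 1 = degree f" using f0 by (simp add: xs_def length_coeffs_degree)
    have "set xs \<subseteq> Qp_bar" using f(1) by (auto simp: xs_def coeffs_def polys_over_def)
    moreover have "hd xs \<noteq> 0"
      using f0 by (simp add: xs_def hd_rev last_coeffs_eq_coeff_degree)
    ultimately have xs: "xs \<in> carrier (poly_ring (Cp\<lparr>carrier := Qp_bar :: 'c set\<rparr>))"
      by (simp add: univ_poly_def polynomial_def)
    then have "L.splitted xs" by (rule L.roots_over_carrier)
    then have "size (L.roots xs) > 0" unfolding L.splitted_def len using f(2) by simp
    then obtain x where "x \<in># L.roots xs" by fastforce
    then have "L.is_root xs x" using L.roots_mem_iff_is_root[OF xs] by simp
    then have x: "x \<in> Qp_bar" "L.eval xs x = 0" unfolding L.is_root_def by auto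
    have "L.eval xs x = ring.eval Cp xs x"
      using ring.eval_consistent[OF ring_Cp subfieldE(1)[OF subfield_Qp_bar]] by metis
    then have "poly f x = 0" using x(2) by (simp add: eval_Cp xs_def)
    then show "\<exists>x\<in>Qp_bar. poly f x = 0" using x(1) by blast
  qed
qed

lemma Qp_bar_algebraic:
  assumes "Qp \<subseteq> K" "(x :: 'c) \<in> Qp_bar"
  shows "\<exists>f\<in>polys_over K. f \<noteq> 0 \<and> poly f x = 0"
proof -
  have "(ring.algebraic Cp over Qp) x" using assms(2) by (simp add: Qp_bar_def)
  from algebraic_over_CpE[OF subfield_Qp this]
  obtain f where "f \<in> polys_over Qp" "f \<noteq> 0" "poly f x = 0" .
  then show ?thesis using polys_over_mono[OF assms(1)] by auto
qed

text \<open>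
  A linear map on the finite-dimensional space \<open>Qp[x]\<close> is bounded. Applied to all powers of \<open>x\<close>
  the bound shows that the constant is irrelevant.
\<close>

lemma automorphism_isometry:
  assumes \<sigma>: "\<sigma> \<in> ring_iso (Cp\<lparr>carrier := Qp_bar :: 'c set\<rparr>) (Cp\<lparr>carrier := Qp_bar\<rparr>)"
    and fix_Qp: "\<And>a. a \<in> Qp \<Longrightarrow> \<sigma> a = a" and x: "x \<in> Qp_bar"
  shows "absv (\<sigma> x) = absv x"
proof -
  interpret Q: Cp_subfield "Qp_bar :: 'c set" by (rule Cp_subfield.intro[OF subfield_Qp_bar])
  interpret Qp: Cp_subfield "Qp :: 'c set" by (rule Cp_subfield.intro[OF subfield_Qp])
  have hom: "\<sigma> a \<in> Qp_bar" "\<sigma> (a + b) = \<sigma> a + \<sigma> b" "\<sigma> (a * b) = \<sigma> a * \<sigma> b"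
    if "a \<in> Qp_bar" "b \<in> Qp_bar" for a b
    using that ring_iso_memE(1-3)[OF \<sigma>] by simp_all
  have hom_1: "\<sigma> 1 = 1" using ring_iso_memE(4)[OF \<sigma>] by simp
  have pow: "\<sigma> (a ^ n) = \<sigma> a ^ n" if "a \<in> Qp_bar" for a n
    using that by (induction n) (simp_all add: hom hom_1 Q.power)
  have le: "absv (\<sigma> x) \<le> absv x" if x: "x \<in> Qp_bar" for x
  proof (cases "x = 0")
    case True
    then show ?thesis using fix_Qp[of 0] by simp
  next
    case False
    obtain m where m: "minpoly Qp x m"
      using Qp_bar_algebraic[OF order_refl x] Qp.minpoly_exists by blast
    obtain us where us: "adjoin Qp x = ring.Span Cp Qp us"
      using finite_extension_Span[OF Qp.finite_extension_adjoin(1)[OF m]] by auto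
    have sub: "adjoin Qp x \<subseteq> Qp_bar"
      unfolding adjoin_def using polys_over_mono[OF Qp_subset] x by auto
    have Sp: "y \<in> Qp_bar" if "y \<in> ring.Span Cp Qp us" for y
      using that sub unfolding us by blast
    have "\<exists>C. \<forall>y\<in>ring.Span Cp Qp us. absv (\<sigma> y) \<le> C * absv y"
    proof (rule linear_map_bounded[OF subfield_Qp locally_compact_Qp])
      show "\<sigma> (y + z) = \<sigma> y + \<sigma> z"
        if "y \<in> ring.Span Cp Qp us" "z \<in> ring.Span Cp Qp us" for y z
        by (rule hom(2)[OF Sp Sp]) fact+
      show "\<sigma> (a * y) = a * \<sigma> y" if a: "a \<in> Qp" and y: "y \<in> ring.Span Cp Qp us" for a y
        using hom(3)[of a y] Sp[OF y] a Qp_subset fix_Qp[OF a] by auto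
    qed
    then obtain C where C: "\<And>y. y \<in> adjoin Qp x \<Longrightarrow> absv (\<sigma> y) \<le> C * absv y"
      unfolding us by auto
    have bound: "(absv (\<sigma> x) / absv x) ^ n \<le> C" for n
    proof -
      have "x ^ n \<in> adjoin Qp x"
        unfolding adjoin_def by (intro image_eqI[of _ _ "Polynomial.monom 1 n"]) (auto simp: poly_monom)
      then have "absv (\<sigma> x) ^ n \<le> C * absv x ^ n"
        using C[of "x ^ n"] pow[OF x] by (simp add: absv_power)
      then show ?thesis using False by (simp add: power_divide field_simps)
    qed
    show ?thesis
    proof (rule ccontr)
      assume "\<not> ?thesis"
      then have "absv (\<sigma> x) / absv x > 1" using False by (simp add: field_simps)
      then obtain n where "C < (absv (\<sigma> x) / absv x) ^ n" using real_arch_pow by blast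
      then show False using bound[of n] by simp
    qed
  qed
  show ?thesis
  proof (cases "x = 0")
    case True
    then show ?thesis using fix_Qp[of 0] by simp
  next
    case False
    \<comment> \<open>The opposite inequality is \<open>le\<close> for the inverse.\<close>
    have ix: "inverse x \<in> Qp_bar" using x by (rule Q.inv)
    have "\<sigma> x * \<sigma> (inverse x) = 1" using hom(3)[OF x ix] hom_1 False by simp
    then have "absv (\<sigma> x) * absv (\<sigma> (inverse x)) = 1" by (simp flip: absv_mult)
    moreover have "absv (\<sigma> x) * absv (\<sigma> (inverse x)) \<le> absv (\<sigma> x) * inverse (absv x)"
      using le[OF ix] by (intro mult_left_mono) (auto simp: absv_inverse)
    ultimately have "absv x \<le> absv (\<sigma> x)" using False by (simp add: field_simps)
    then show ?thesis using le[OF x] by simp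
  qed
qed

text \<open>An isometry is uniformly continuous, so it has exactly one continuous extension from the
  dense set \<open>Qp_bar\<close>; this makes the definite description in
  \<open>galois_action\<close> meaningful.\<close>

lemma galois_action_eq:
  assumes \<sigma>: "\<sigma> \<in> ring_iso (Cp\<lparr>carrier := Qp_bar :: 'c set\<rparr>) (Cp\<lparr>carrier := Qp_bar\<rparr>)"
    and fix_Qp: "\<And>a. a \<in> Qp \<Longrightarrow> \<sigma> a = a" and x: "x \<in> Qp_bar"
  shows "galois_action \<sigma> x = \<sigma> x"
proof -
  interpret Q: Cp_subfield "Qp_bar :: 'c set" by (rule Cp_subfield.intro[OF subfield_Qp_bar])
  have diff: "\<sigma> a - \<sigma> b = \<sigma> (a - b)" if ab: "a \<in> Qp_bar" "b \<in> Qp_bar" for a b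
  proof -
    have "a - b \<in> Qp_bar" using ab by (rule Q.diff)
    then have "\<sigma> ((a - b) + b) = \<sigma> (a - b) + \<sigma> b"
      using ring_iso_memE(3)[OF \<sigma>, of "a - b" b] ab by simp
    then show ?thesis by simp
  qed
  have iso: "dist (\<sigma> a) (\<sigma> b) = dist a b" if ab: "a \<in> Qp_bar" "b \<in> Qp_bar" for a b
    unfolding dist_absv diff[OF ab] by (rule automorphism_isometry[OF \<sigma> fix_Qp Q.diff[OF ab]])
  have uc: "uniformly_continuous_on Qp_bar \<sigma>"
    unfolding uniformly_continuous_on_def using iso by auto
  obtain \<tau> where \<tau>: "uniformly_continuous_on (closure Qp_bar) \<tau>" "\<And>x. x \<in> Qp_bar \<Longrightarrow> \<sigma> x = \<tau> x"
    "\<And>Y h x. Qp_bar \<subseteq> Y \<Longrightarrow> Y \<subseteq> closure Qp_bar \<Longrightarrow> continuous_on Y h \<Longrightarrow>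
      (\<And>x. x \<in> Qp_bar \<Longrightarrow> \<sigma> x = h x) \<Longrightarrow> x \<in> Y \<Longrightarrow> h x = \<tau> x"
    by (rule uniformly_continuous_on_extension_on_closure[OF uc]) blast
  have "galois_action \<sigma> = \<tau>"
    unfolding galois_action_def
  proof (rule the_equality)
    show "continuous_on UNIV \<tau> \<and> (\<forall>x\<in>Qp_bar. \<tau> x = \<sigma> x)"
      using \<tau>(1,2) uniformly_continuous_imp_continuous by (auto simp: dense_Qp_bar)
    fix h assume h: "continuous_on UNIV h \<and> (\<forall>x\<in>Qp_bar. h x = \<sigma> x)"
    show "h = \<tau>"
      by (rule ext, rule \<tau>(3)[of UNIV]) (use h in \<open>auto simp: dense_Qp_bar\<close>)
  qed
  then show ?thesis using \<tau>(2)[OF x] by simp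
qed

text \<open>The one place where \<open>defined_over\<close> is used: some automorphism over
  \<open>E\<close> takes \<open>x\<close> to its conjugate \<open>y\<close>, and its extension maps
  \<open>D\<close> onto itself.\<close>

lemma conjugate_in_defined_over:
  assumes E: "is_finite_extension Qp (E :: 'c set)" and D: "defined_over E D"
    and m: "minpoly E x m" "x \<in> Qp_bar" "x \<in> D" and y: "y \<in> Qp_bar" "poly m y = 0"
  shows "y \<in> D"
proof -
  interpret Q: Cp_algebraically_closed "Qp_bar :: 'c set" by (rule algebraically_closed_Qp_bar)
  have QpE: "Qp \<subseteq> E" "subfield E Cp" "E \<subseteq> Qp_bar"
    using E finite_extension_of_Qp_subset[OF E] by (auto simp: is_finite_extension_def)
  obtain \<sigma> where \<sigma>: "\<sigma> \<in> ring_iso (Cp\<lparr>carrier := Qp_bar :: 'c set\<rparr>) (Cp\<lparr>carrier := Qp_bar\<rparr>)"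
    "\<And>a. a \<in> E \<Longrightarrow> \<sigma> a = a" "\<sigma> x = y"
    using Q.automorphism_exists[OF QpE(2,3) Qp_bar_algebraic[OF QpE(1)] m(1,2) y] by metis
  have "galois_action \<sigma> x = y"
    using galois_action_eq[OF \<sigma>(1) \<sigma>(2) m(2)] QpE(1) \<sigma>(3) by auto
  moreover have "galois_action \<sigma> ` D = D"
    using D \<sigma>(1,2) by (auto simp: defined_over_def galois_group_def)
  ultimately show ?thesis using m(3) by blast
qed

end

section \<open>Ramification indices\<close>

text \<open>The coset of \<open>absv x\<close> modulo the value group of \<open>K\<close>. It does
  not mention the extension, so the cosets of two extensions compare by inclusion.\<close>

definition values_coset :: "'a::{field_char_0,metric_space} set \<Rightarrow> 'a \<Rightarrow> real set"
  where "values_coset K x = (\<lambda>a. absv a * absv x) ` (K - {0})"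

lemma ramification_index_eq:
  "ramification_index K F = card (values_coset K ` (F - {0}))"
proof -
  have "rcosets\<^bsub>value_group F\<^esub> carrier (value_group K) = values_coset K ` (F - {0})"
    unfolding RCOSETS_def r_coset_def values_coset_def value_group_def by auto
  then show ?thesis by (simp add: ramification_index_def)
qed

definition inequivalent_values :: "'a::{field_char_0,metric_space} set \<Rightarrow> 'a list \<Rightarrow> bool"
  where "inequivalent_values K us \<longleftrightarrow> 0 \<notin> set us \<and> distinct us \<and> inj_on (values_coset K) (set us)"

context padic_complex
begin

lemma values_coset_eqI:
  assumes "subfield K Cp" "a \<in> K" "a \<noteq> 0" "absv (x :: 'c) = absv a * absv y"
  shows "values_coset K x = values_coset K y"
proof -
  interpret K: Cp_subfield K by (rule Cp_subfield.intro[OF assms(1)])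
  have "values_coset K x \<subseteq> values_coset K y"
  proof
    fix v assume "v \<in> values_coset K x"
    then obtain b where b: "b \<in> K" "b \<noteq> 0" "v = absv b * absv x" by (auto simp: values_coset_def)
    then show "v \<in> values_coset K y" unfolding values_coset_def
      using assms by (intro image_eqI[of _ _ "b * a"]) (auto simp: absv_mult)
  qed
  moreover have "values_coset K y \<subseteq> values_coset K x"
  proof
    fix v assume "v \<in> values_coset K y"
    then obtain b where b: "b \<in> K" "b \<noteq> 0" "v = absv b * absv y" by (auto simp: values_coset_def)
    then show "v \<in> values_coset K x" unfolding values_coset_def
      using assms by (intro image_eqI[of _ _ "b / a"]) (auto simp: absv_divide)
  qed
  ultimately show ?thesis by blast
qed

lemma values_coset_eqD:
  assumes "subfield K Cp" "values_coset K (x :: 'c) = values_coset K y"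
  shows "\<exists>a\<in>K - {0}. absv x = absv a * absv y"
proof -
  interpret K: Cp_subfield K by (rule Cp_subfield.intro[OF assms(1)])
  have "absv x \<in> values_coset K x"
    unfolding values_coset_def by (intro image_eqI[of _ _ 1]) auto
  then show ?thesis unfolding assms(2) by (auto simp: values_coset_def)
qed

text \<open>Nonzero terms from different cosets have different absolute values, so nothing cancels:
  a sum has the absolute value of its largest term.\<close>

lemma values_coset_Span:
  assumes K: "subfield K Cp" and us: "inequivalent_values K us"
    and w: "(w :: 'c) \<in> ring.Span Cp K us" "w \<noteq> 0"
  shows "values_coset K w \<in> values_coset K ` set us"
  using us w
proof (induction us arbitrary: w)
  case (Cons u us)
  interpret K: Cp_subfield K by (rule Cp_subfield.intro[OF K])
  obtain a v where av: "a \<in> K" "v \<in> ring.Span Cp K us" "w = a * u + v" using Cons.prems(2) by auto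
  have us: "inequivalent_values K us" using Cons.prems(1) by (auto simp: inequivalent_values_def)
  have a: "values_coset K (a * u) = values_coset K u" if "a \<noteq> 0"
    by (rule values_coset_eqI[OF K av(1) that]) (simp add: absv_mult)
  consider "a = 0" | "a \<noteq> 0" "v = 0" | "a \<noteq> 0" "v \<noteq> 0" by blast
  then show ?case
  proof cases
    case 1
    then show ?thesis using Cons.IH[OF us av(2)] Cons.prems(3) av(3) by auto
  next
    case 2
    then show ?thesis using a av(3) by simp
  next
    case 3
    have v: "values_coset K v \<in> values_coset K ` set us" by (rule Cons.IH[OF us av(2) 3(2)])
    have "values_coset K u \<notin> values_coset K ` set us"
      using Cons.prems(1) unfolding inequivalent_values_def by (auto simp: inj_on_def)
    then have "values_coset K v \<noteq> values_coset K (a * u)" using v a[OF 3(1)] by auto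
    then have "absv v \<noteq> absv (a * u)" unfolding values_coset_def by auto
    then have "absv w = max (absv (a * u)) (absv v)"
      unfolding av(3) by (intro absv_add_neq) auto
    then have "values_coset K w = values_coset K (a * u) \<or> values_coset K w = values_coset K v"
      unfolding values_coset_def by (auto simp: max_def)
    then show ?thesis using v a[OF 3(1)] by auto
  qed
qed simp

lemma inequivalent_values_independent:
  assumes K: "subfield K Cp" and us: "inequivalent_values K (us :: 'c list)"
  shows "ring.independent Cp K us"
  using us
proof (induction us)
  case Nil
  show ?case by (rule ring.li_Nil[OF ring_Cp])
next
  case (Cons u us)
  interpret K: Cp_subfield K by (rule Cp_subfield.intro[OF K])
  have us: "inequivalent_values K us" and u: "u \<noteq> 0"
    using Cons.prems by (auto simp: inequivalent_values_def)
  have "values_coset K u \<notin> values_coset K ` set us"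
    using Cons.prems unfolding inequivalent_values_def by (auto simp: inj_on_def)
  then have "u \<notin> ring.Span Cp K us" using values_coset_Span[OF K us _ u] by blast
  then show ?case using Cons.IH[OF us] by (intro K.Cp.li_Cons) auto
qed

lemma values_coset_representatives:
  assumes "finite G" "G \<subseteq> values_coset K ` (F - {0})"
  obtains us :: "'c list" where "set us \<subseteq> F - {0}" "inequivalent_values K us"
    "values_coset K ` set us = G" "length us = card G"
proof -
  have "\<forall>g\<in>G. \<exists>x. x \<in> F - {0} \<and> values_coset K x = g" using assms(2) by blast
  from bchoice[OF this] obtain r where "\<forall>g\<in>G. r g \<in> F - {0} \<and> values_coset K (r g) = g" ..
  then have r: "r g \<in> F - {0}" "values_coset K (r g) = g" if "g \<in> G" for g using that by simp_all
  have inj: "inj_on r G" by (rule inj_on_inverseI[of _ "values_coset K"]) (rule r(2))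
  obtain us where us: "set us = r ` G" "distinct us"
    using finite_distinct_list[of "r ` G"] assms(1) by auto
  show ?thesis
  proof (rule that)
    show "set us \<subseteq> F - {0}" unfolding us(1) using r(1) by (rule image_subsetI)
    show "inequivalent_values K us"
      unfolding inequivalent_values_def
    proof (intro conjI)
      show "0 \<notin> set us" unfolding us(1) using r(1) by force
      show "inj_on (values_coset K) (set us)"
        unfolding us(1) by (rule inj_on_inverseI[of _ r]) (auto simp: r(2))
    qed (fact us(2))
    show "values_coset K ` set us = G" unfolding us(1) image_image by (simp add: r(2))
    show "length us = card G" using distinct_card[OF us(2)] card_image[OF inj] by (simp add: us(1))
  qed
qed

text \<open>Finiteness belongs to the conclusion because \<open>card\<close> is 0 on infinite sets;
  a bound on all finite sets of cosets yields both parts.\<close>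

lemma ramification_index_le:
  assumes "is_finite_extension K (F :: 'c set)"
  shows "finite (values_coset K ` (F - {0})) \<and> ramification_index K F \<le> ext_degree K F"
  unfolding ramification_index_eq
proof (rule finite_if_finite_subsets_card_bdd)
  have K: "subfield K Cp" and fd: "ring.finite_dimension Cp K F"
    using assms by (auto simp: is_finite_extension_def)
  interpret K: Cp_subfield K by (rule Cp_subfield.intro[OF K])
  fix G assume G: "G \<subseteq> values_coset K ` (F - {0})" "finite G"
  obtain us where us: "set us \<subseteq> F - {0}" "inequivalent_values K us" "length us = card G"
    using values_coset_representatives[OF G(2,1)] by metis
  have "length us \<le> ext_degree K F"
    using K.Cp.independent_length_le_dimension[OF K K.Cp.finite_dimensionE[OF K fd]
        inequivalent_values_independent[OF K us(2)]] us(1)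
    by (auto simp: ext_degree_def over_def)
  then show "card G \<le> ext_degree K F" using us(3) by simp
qed

text \<open>
  Representatives of the value cosets span the extension: otherwise an element outside their span
  could be approximated strictly better than by its best approximation.
\<close>

lemma ext_degree_eq_ramification_index:
  assumes lc: "locally_compact_set (K :: 'c set)" and ext: "is_finite_extension K F"
    and residue: "\<And>y. y \<in> F \<Longrightarrow> absv y = 1 \<Longrightarrow> \<exists>d\<in>K. absv (y - d) < 1"
  shows "ext_degree K F = ramification_index K F"
proof -
  have K: "subfield K Cp" and F: "subfield F Cp" and KF: "K \<subseteq> F"
    using ext by (auto simp: is_finite_extension_def)
  interpret K: Cp_subfield K by (rule Cp_subfield.intro[OF K])
  interpret F: Cp_subfield F by (rule Cp_subfield.intro[OF F])
  obtain us where us: "set us \<subseteq> F - {0}" "inequivalent_values K us"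
    "values_coset K ` set us = values_coset K ` (F - {0})" "length us = ramification_index K F"
    using values_coset_representatives[of "values_coset K ` (F - {0})" K F]
      ramification_index_le[OF ext] unfolding ramification_index_eq by auto
  let ?V = "ring.Span Cp K us"
  have VF: "?V \<subseteq> F"
    using us(1)
  proof (induction us)
    case (Cons u us)
    then have "w \<in> F" if "w \<in> ring.Span Cp K us" for w using \<open>w \<in> ring.Span Cp K us\<close> by auto
    moreover have "u \<in> F" using Cons.prems by auto
    ultimately show ?case using KF by (auto intro!: F.add F.mult)
  qed auto
  have mem: "u \<in> ?V" if "u \<in> set us" for u
    using K.Cp.Span_base_incl[OF K, of us] that by auto
  have "x \<in> ?V" if xF: "x \<in> F" for x
  proof (rule ccontr)
    assume xV: "x \<notin> ?V"
    have V0: "0 \<in> ?V"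
      using subgroup.one_closed[OF K.Cp.Span_is_add_subgroup[OF K], of us] by simp
    \<comment> \<open>A best approximation is sought only within radius \<open>absv x\<close>; the
      improved point \<open>w\<close> below stays within that radius too.\<close>
    have "compact (?V \<inter> cball 0 (absv x))"
      using locally_compact_Span[OF K lc] by (simp add: locally_compact_set_def)
    moreover have "?V \<inter> cball 0 (absv x) \<noteq> {}" using V0 by auto
    ultimately obtain v where v: "v \<in> ?V \<inter> cball 0 (absv x)"
      "\<And>w. w \<in> ?V \<inter> cball 0 (absv x) \<Longrightarrow> dist x v \<le> dist x w"
      using continuous_attains_inf[OF _ _ continuous_on_dist[OF continuous_on_const continuous_on_id]]
      by meson
    have z: "x - v \<in> F" "x - v \<noteq> 0" using v VF xF xV by auto
    then have "values_coset K (x - v) \<in> values_coset K ` set us" using us(3) by auto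
    then obtain u where u: "u \<in> set us" "values_coset K (x - v) = values_coset K u" by auto
    obtain a where a: "a \<in> K" "a \<noteq> 0" "absv (x - v) = absv a * absv u"
      using values_coset_eqD[OF K u(2)] by auto
    have u0: "u \<noteq> 0" "u \<in> F" using u(1) us(1) by auto
    \<comment> \<open>The error, scaled to a unit of \<open>F\<close>. Approximating
      \<open>y\<close> by \<open>d\<close> in \<open>K\<close> and adding \<open>d * a * u\<close>
      to \<open>v\<close> makes the error strictly smaller.\<close>
    define y where "y = (x - v) / (a * u)"
    have "y \<in> F" unfolding y_def using z(1) a(1) KF u0 by (intro F.divide F.mult) auto
    moreover have "absv y = 1" using a u0 by (simp add: y_def absv_divide absv_mult)
    ultimately obtain d where d: "d \<in> K" "absv (y - d) < 1" using residue by blast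
    define w where "w = v + (d * a) * u"
    have "w \<in> ?V"
      unfolding w_def using v(1) d a mem[OF u(1)] by (intro K.Span_add K.Span_mult) auto
    have "x - w = (y - d) * (a * u)" using a(2) u0 by (simp add: w_def y_def field_simps)
    then have "absv (x - w) = absv (y - d) * absv (x - v)" by (simp add: absv_mult a(3))
    then have less: "absv (x - w) < absv (x - v)" using d(2) z(2) by simp
    have "absv (x - v) \<le> absv x" using absv_diff[of x v] v(1) by (auto simp: dist_0_absv)
    then have "absv w \<le> absv x" using absv_diff[of x "x - w"] less by auto
    then have "dist x v \<le> dist x w" using v(2) \<open>w \<in> ?V\<close> by (auto simp: dist_0_absv)
    then show False using less by (simp add: dist_absv)
  qed
  then have "?V = F" using VF by blast
  from K.Cp.dimensionI[OF K inequivalent_values_independent[OF K us(2)] this]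
  have "K.Cp.dimension (length us) K F" .
  from K.Cp.dimI[OF K this] show ?thesis by (simp add: ext_degree_def over_def us(4))
qed

end

text \<open>The coefficient of \<open>T ^ q\<close> in \<open>f (X + T)\<close>, that is, the
  \<open>q\<close>-th derivative divided by \<open>q!\<close>. Binomial coefficients show its
  \<open>p\<close>-adic size; the list is long enough because later coefficients vanish.\<close>

definition hasse_deriv :: "nat \<Rightarrow> 'a::field_char_0 poly \<Rightarrow> 'a poly"
  where "hasse_deriv q f = Poly (map (\<lambda>i. of_nat (i + q choose q) * coeff f (i + q)) [0..<Suc (degree f)])"

lemma coeff_hasse_deriv: "coeff (hasse_deriv q f) i = of_nat (i + q choose q) * coeff f (i + q)"
  unfolding hasse_deriv_def coeff_Poly_eq nth_default_def
  by (auto simp: coeff_eq_0 simp del: upt_Suc)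

text \<open>Leibniz rule: a monic linear factor contributes only in orders 0 and 1.\<close>

lemma hasse_deriv_linear_factor:
  "hasse_deriv (Suc q) ([:- a, 1:] * f) = [:- a, 1:] * hasse_deriv (Suc q) f + hasse_deriv q f"
proof (rule poly_eqI)
  fix i
  have c: "coeff ([:- a, 1:] * g) j = (case j of 0 \<Rightarrow> 0 | Suc k \<Rightarrow> coeff g k) - a * coeff g j"
    for g :: "'a poly" and j
    by (simp add: coeff_pCons)
  show "coeff (hasse_deriv (Suc q) ([:- a, 1:] * f)) i =
      coeff ([:- a, 1:] * hasse_deriv (Suc q) f + hasse_deriv q f) i"
    unfolding coeff_add c coeff_hasse_deriv by (cases i) (simp_all add: algebra_simps)
qed

lemma hasse_deriv_0: "hasse_deriv 0 f = f"
  by (rule poly_eqI) (simp add: coeff_hasse_deriv)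

lemma (in Cp_subfield) polys_over_hasse_deriv: "f \<in> polys_over K \<Longrightarrow> hasse_deriv q f \<in> polys_over K"
  by (auto simp: polys_over_def coeff_hasse_deriv intro!: mult of_nat)

context padic_complex
begin

text \<open>The value is the elementary symmetric function of degree \<open>length as - q\<close> in
  the differences \<open>x - a\<close>. The Leibniz rule gives the bound by induction.\<close>

lemma absv_hasse_deriv_le:
  assumes "\<And>a. a \<in> set as \<Longrightarrow> absv (x - a :: 'c) \<le> M" "q \<le> length as" "M \<ge> 0"
  shows "absv (poly (hasse_deriv q (\<Prod>a\<leftarrow>as. [:- a, 1:])) x) \<le> M ^ (length as - q)"
  using assms
proof (induction as arbitrary: q)
  case Nil
  then show ?case by (simp add: hasse_deriv_0)
next
  case (Cons a as)
  let ?f = "\<Prod>a\<leftarrow>as. [:- a, 1:]"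
  have step: "absv ((x - a) * poly (hasse_deriv q ?f) x) \<le> M ^ (Suc (length as) - q)"
    if q: "q \<le> length as" for q
  proof -
    have "absv (x - a) * absv (poly (hasse_deriv q ?f) x) \<le> M * M ^ (length as - q)"
      using Cons q by (intro mult_mono) auto
    then show ?thesis using q by (simp add: absv_mult Suc_diff_le)
  qed
  show ?case
  proof (cases q)
    case 0
    then show ?thesis using step[of 0] by (simp add: hasse_deriv_0 algebra_simps)
  next
    case (Suc r)
    have 1: "absv (poly (hasse_deriv r ?f) x) \<le> M ^ (Suc (length as) - q)"
      using Cons.IH[of r] Cons.prems Suc by auto
    have 2: "absv ((x - a) * poly (hasse_deriv q ?f) x) \<le> M ^ (Suc (length as) - q)"
    \<comment> \<open>Here \<open>q\<close> may be one more than \<open>length as\<close>, and then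
      the derivative of the shorter product is zero.\<close>
    proof (cases "q \<le> length as")
      case False
      have "hasse_deriv q ?f = 0"
        by (rule poly_eqI) (use False in \<open>simp add: coeff_hasse_deriv coeff_eq_0 degree_prod_roots\<close>)
      then show ?thesis using Cons.prems(3) by simp
    qed (rule step)
    have "poly (hasse_deriv q (\<Prod>a\<leftarrow>(a # as). [:- a, 1:])) x =
        (x - a) * poly (hasse_deriv q ?f) x + poly (hasse_deriv r ?f) x"
      unfolding Suc list.map prod_list.Cons hasse_deriv_linear_factor by (simp add: algebra_simps)
    then show ?thesis using absv_add_le[OF 2 1] by simp
  qed
qed

end

section \<open>Points of least degree\<close>

text \<open>What the estimates retain of a disk; from here on open and closed disks are treated
  alike.\<close>

definition separated :: "'a::metric_space set \<Rightarrow> bool"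
  where "separated D \<longleftrightarrow> (\<forall>x\<in>D. \<forall>y\<in>D. \<forall>z. z \<notin> D \<longrightarrow> dist x y < dist x z)"

text \<open>Recording that the conjugates of \<open>x\<close> lie in \<open>D\<close> removes the
  Galois action from the rest of the argument.\<close>

definition minimal_degree_point ::
    "'a::{field_char_0,metric_space} set \<Rightarrow> 'a set \<Rightarrow> 'a \<Rightarrow> 'a poly \<Rightarrow> bool"
  where "minimal_degree_point K D x m \<longleftrightarrow> minpoly K x m \<and> x \<in> D \<and> x \<in> Qp_bar \<and>
    (\<forall>y\<in>Qp_bar. poly m y = 0 \<longrightarrow> y \<in> D) \<and>
    (\<forall>f\<in>polys_over K. \<forall>y\<in>D \<inter> Qp_bar. f \<noteq> 0 \<and> poly f y = 0 \<longrightarrow> degree m \<le> degree f)"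

lemma prod_list_greater_power:
  fixes M :: real
  assumes "\<And>b. b \<in> set bs \<Longrightarrow> M < b" "M \<ge> 0" "bs \<noteq> []"
  shows "M ^ length bs < prod_list bs"
  using assms
proof (induction bs)
  case (Cons b bs)
  show ?case
  proof (cases "bs = []")
    case False
    then have "M ^ length bs < prod_list bs" using Cons by auto
    moreover have "M < b" "M \<ge> 0" using Cons.prems by auto
    ultimately show ?thesis by (auto intro!: mult_strict_mono')
  qed (use Cons.prems in auto)
qed simp

context padic_complex
begin

lemma disk_separated:
  assumes "is_disk (D :: 'c set)"
  shows "separated D"
proof -
  obtain a r where D: "D = cball a r \<or> D = ball a r" using assms by (auto simp: is_disk_def)
  have tri: "dist x z \<le> max (dist x y) (dist y z)" for x y z :: 'c
    using absv_ultrametric[of "x - y" "y - z"] by (simp add: dist_absv)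
  show ?thesis
    unfolding separated_def
  proof (intro ballI allI impI)
    fix x y z assume "x \<in> D" "y \<in> D" "z \<notin> D"
    then show "dist x y < dist x z"
      using D tri[of x y a] tri[of a z x] by (auto simp: dist_commute)
  qed
qed

lemma minimal_degree_point_exists:
  assumes E: "is_finite_extension Qp (E :: 'c set)" and D: "is_disk D" "defined_over E D"
  obtains x m where "minimal_degree_point E D x m"
proof -
  have QpE: "Qp \<subseteq> E" "subfield E Cp" using E by (auto simp: is_finite_extension_def)
  interpret E: Cp_subfield E by (rule Cp_subfield.intro[OF QpE(2)])
  obtain a r where ar: "r > 0" "ball a r \<subseteq> D"
    using D(1) ball_subset_cball unfolding is_disk_def by blast
  have "a \<in> closure Qp_bar" by (simp add: dense_Qp_bar)
  then obtain z where "z \<in> Qp_bar" "dist z a < r" using ar(1) unfolding closure_approachable by blast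
  then have z: "z \<in> Qp_bar" "z \<in> D" using ar(2) by (auto simp: dist_commute)
  \<comment> \<open>Minimizing over pairs of a polynomial and a root compares all algebraic points
    of \<open>D\<close> at once; passing to the minimal polynomial of the root does not raise the
    degree.\<close>
  let ?P = "\<lambda>(f, y). f \<in> polys_over E \<and> y \<in> D \<inter> Qp_bar \<and> f \<noteq> 0 \<and> poly f y = 0"
  obtain g where "?P (g, z)" using Qp_bar_algebraic[OF QpE(1) z(1)] z by auto
  from ex_has_least_nat[of ?P, OF this, of "degree \<circ> fst"]
  obtain f x where fx: "?P (f, x)" and least: "\<And>g y. ?P (g, y) \<Longrightarrow> degree f \<le> degree g" by auto
  obtain m where m: "minpoly E x m" using E.minpoly_exists fx by auto
  have "degree m \<le> degree f" using minpolyD(4)[OF m] fx by auto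
  then have "degree m \<le> degree g" if "?P (g, y)" for g y
    using least[of g y] that by auto
  moreover have "y \<in> D" if "y \<in> Qp_bar" "poly m y = 0" for y
    using conjugate_in_defined_over[OF E D(2) m _ _ that] fx by auto
  ultimately show ?thesis
    using that m fx unfolding minimal_degree_point_def by blast
qed

section \<open>Degree, residues and values at a point of least degree\<close>

context
  fixes E D :: "'c set" and x :: 'c and m :: "'c poly"
  assumes E: "is_finite_extension Qp E" and D: "separated D" and min: "minimal_degree_point E D x m"
begin

interpretation E: Cp_subfield E
  by (rule Cp_subfield.intro) (use E in \<open>simp add: is_finite_extension_def\<close>)

interpretation Q: Cp_algebraically_closed "Qp_bar :: 'c set"
  by (rule algebraically_closed_Qp_bar)

lemma minimal_minpoly: "minpoly E x m" and minimal_in: "x \<in> D" "x \<in> Qp_bar"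
  and minimal_roots_in: "\<And>y. y \<in> Qp_bar \<Longrightarrow> poly m y = 0 \<Longrightarrow> y \<in> D"
  and minimal_least_degree: "\<And>f y. f \<in> polys_over E \<Longrightarrow> f \<noteq> 0 \<Longrightarrow> y \<in> D \<Longrightarrow> y \<in> Qp_bar \<Longrightarrow> poly f y = 0 \<Longrightarrow>
    degree m \<le> degree f"
  using min unfolding minimal_degree_point_def by auto

lemma E_subset_Qp_bar: "E \<subseteq> Qp_bar"
  by (rule finite_extension_of_Qp_subset[OF E])

lemma minpoly_splits:
  obtains as where "set as \<subseteq> Qp_bar" "set as \<subseteq> D" "m = (\<Prod>a\<leftarrow>as. [:- a, 1:])" "length as = degree m"
proof -
  have "m \<in> polys_over Qp_bar" using minpolyD(1)[OF minimal_minpoly] polys_over_mono[OF E_subset_Qp_bar] by auto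
  from Q.splits[OF this minpolyD(5)[OF minimal_minpoly]] minpolyD(2)[OF minimal_minpoly]
  obtain as where as: "set as \<subseteq> Qp_bar" "m = (\<Prod>a\<leftarrow>as. [:- a, 1:])" by auto
  have "a \<in> D" if a: "a \<in> set as" for a
    using minimal_roots_in[of a] as(1) a unfolding as(2) poly_prod_roots_eq_0_iff by auto
  then show ?thesis using that[of as] as by (auto simp: degree_prod_roots)
qed

text \<open>
  Ax's argument: if \<open>degree m = p ^ k * d\<close> with \<open>d > 1\<close> prime to \<open>p\<close>, then the Hasse derivative of
  order \<open>p ^ k\<close> has leading coefficient a unit, and therefore a root in \<open>D\<close> of smaller degree.
\<close>

lemma degree_eq_prime_power: "\<exists>k. degree m = p ^ k"
proof -
  note mD = minpolyD[OF minimal_minpoly]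
  define k where "k = multiplicity p (degree m)"
  define q where "q = p ^ k"
  have "degree m \<noteq> 0" using mD(6) by simp
  moreover have "\<not> is_unit p" using p_gt_1 by simp
  ultimately obtain d where d: "degree m = q * d" "\<not> p dvd d"
    using multiplicity_decompose'[of "degree m" p] unfolding q_def k_def by metis
  have "d = 1"
  proof (rule ccontr)
    assume "d \<noteq> 1"
    have "d \<noteq> 0" using d mD(6) by (intro notI) simp
    with \<open>d \<noteq> 1\<close> have "d > 1" by simp
    have q0: "q > 0" using p_gt_1 by (simp add: q_def)
    then have qn: "q < degree m" using d(1) \<open>d > 1\<close> by simp
    \<comment> \<open>The count from Wielandt's proof of Sylow's theorem: the binomial coefficient
      of \<open>p ^ k * d\<close> over \<open>p ^ k\<close> contains \<open>p\<close> as often as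
      \<open>d\<close> does.\<close>
    have "multiplicity p (degree m choose q) = multiplicity p d"
      unfolding d(1) unfolding q_def using \<open>d > 1\<close> prime_p by (intro const_p_fac) auto
    also have "\<dots> = 0" using d(2) by (simp add: not_dvd_imp_multiplicity_0)
    finally have "\<not> p dvd (degree m choose q)"
      using qn prime_p multiplicity_eq_zero_iff[of "degree m choose q" p]
      by (auto simp: prime_elem_multiplicity_eq_zero_iff not_prime_unit)
    then have unit: "absv (of_nat (degree m choose q) :: 'c) = 1" by (rule absv_of_nat_eq_1)
    define h where "h = hasse_deriv q m"
    have h: "h \<in> polys_over E" unfolding h_def by (rule E.polys_over_hasse_deriv[OF mD(1)])
    have lc: "coeff h (degree m - q) = of_nat (degree m choose q)"
      using qn mD(2) by (simp add: h_def coeff_hasse_deriv)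
    have "degree h \<le> degree m - q"
      by (rule degree_le) (auto simp: h_def coeff_hasse_deriv coeff_eq_0)
    moreover have nz: "coeff h (degree m - q) \<noteq> 0"
      unfolding lc using unit by (metis absv_0 zero_neq_one)
    ultimately have deg: "degree h = degree m - q" by (meson le_antisym le_degree)
    have h0: "h \<noteq> 0" using nz by auto
    have "h \<in> polys_over Qp_bar" using h polys_over_mono[OF E_subset_Qp_bar] by auto
    from Q.splits[OF this h0] obtain bs
      where bs: "set bs \<subseteq> Qp_bar" "h = smult (lead_coeff h) (\<Prod>b\<leftarrow>bs. [:- b, 1:])" by blast
    have "degree h = length bs"
      by (subst bs(2)) (use h0 in \<open>simp add: degree_prod_roots\<close>)
    then have len: "length bs = degree m - q" using deg by simp
    have bD: "b \<notin> D" if b: "b \<in> set bs" for b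
    proof
      assume "b \<in> D"
      have "poly h b = 0" by (subst bs(2)) (use b in \<open>simp add: poly_prod_roots_eq_0_iff\<close>)
      then have "degree m \<le> degree h" using minimal_least_degree[OF h h0 \<open>b \<in> D\<close>] bs(1) b by auto
      then show False using deg qn q0 by simp
    qed
    obtain as where as: "set as \<subseteq> Qp_bar" "set as \<subseteq> D" "m = (\<Prod>a\<leftarrow>as. [:- a, 1:])"
      "length as = degree m" by (rule minpoly_splits)
    \<comment> \<open>The largest distance from \<open>x\<close> to a conjugate. It bounds
      \<open>poly h x\<close> by \<open>M ^ (degree m - q)\<close>, whereas the roots of
      \<open>h\<close> lie outside \<open>D\<close>, all farther from \<open>x\<close> than
      \<open>M\<close>, and force a larger value.\<close>
    define M where "M = Max ((\<lambda>a. absv (x - a)) ` set as)"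
    have "as \<noteq> []" using as(4) mD(6) by auto
    then have "M \<in> (\<lambda>a. absv (x - a)) ` set as" unfolding M_def by (intro Max_in) auto
    then obtain a0 where a0: "a0 \<in> set as" "M = absv (x - a0)" by auto
    have M: "absv (x - a) \<le> M" if "a \<in> set as" for a
      unfolding M_def using that by (intro Max_ge) auto
    have "absv (poly h x) \<le> M ^ (degree m - q)"
      using absv_hasse_deriv_le[of as x M q] M a0(2) qn as(3,4) by (simp add: h_def)
    moreover have "M ^ length (map (\<lambda>b. absv (x - b)) bs) < (\<Prod>b\<leftarrow>bs. absv (x - b))"
    proof (rule prod_list_greater_power)
      fix t assume "t \<in> set (map (\<lambda>b. absv (x - b)) bs)"
      then obtain b where b: "b \<in> set bs" "t = absv (x - b)" by auto
      show "M < t"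
        using D minimal_in(1) a0 as(2) bD[OF b(1)] unfolding separated_def a0(2) b(2) dist_absv by blast
    qed (use a0(2) len qn in auto)
    moreover have "absv (poly h x) = (\<Prod>b\<leftarrow>bs. absv (x - b))"
    proof -
      have "lead_coeff h = of_nat (degree m choose q)" using lc deg by simp
      then have "absv (lead_coeff h) = 1" using unit by simp
      then show ?thesis
        by (subst bs(2)) (simp add: absv_mult poly_prod_roots absv_prod_list o_def)
    qed
    ultimately show False using len by simp
  qed
  then show ?thesis using d(1) by (auto simp: q_def)
qed

text \<open>
  A polynomial without roots in \<open>D\<close> is nearly constant on \<open>D\<close>, so its values there have the same
  absolute value and, when that is 1, the same residue.
\<close>

lemma absv_poly_diff_less:
  assumes f: "f \<in> polys_over E" "f \<noteq> 0" "degree f < degree m" and yz: "y \<in> D" "z \<in> D"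
  shows "absv (poly f y - poly f z) < absv (poly f z)"
proof -
  have "f \<in> polys_over Qp_bar" using f(1) polys_over_mono[OF E_subset_Qp_bar] by auto
  from Q.splits[OF this f(2)] obtain bs
    where bs: "set bs \<subseteq> Qp_bar" "f = smult (lead_coeff f) (\<Prod>b\<leftarrow>bs. [:- b, 1:])" by blast
  have bD: "b \<notin> D" if b: "b \<in> set bs" for b
  proof
    assume "b \<in> D"
    have "poly f b = 0" by (subst bs(2)) (use b in \<open>simp add: poly_prod_roots_eq_0_iff\<close>)
    then have "degree m \<le> degree f" using minimal_least_degree[OF f(1,2) \<open>b \<in> D\<close>] bs(1) b by auto
    then show False using f(3) by simp
  qed
  have "absv ((\<Prod>b\<leftarrow>bs. y - b) - (\<Prod>b\<leftarrow>bs. z - b)) < absv (\<Prod>b\<leftarrow>bs. z - b)"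
    using bD
  proof (induction bs)
    case (Cons b bs)
    define s t where "s = (\<Prod>b\<leftarrow>bs. y - b)" and "t = (\<Prod>b\<leftarrow>bs. z - b)"
    have IH: "absv (s - t) < absv t" using Cons by (simp add: s_def t_def)
    have b: "absv ((y - b) - (z - b)) < absv (z - b)"
      using D yz Cons.prems[of b] unfolding separated_def
      by (simp flip: dist_absv) (metis dist_commute)
    have yb: "absv (y - b) = absv (z - b)" by (rule absv_eq_if_close[OF b])
    have pos: "absv (z - b) > 0" "absv t > 0"
      using b IH absv_nonneg by (meson order_le_less_trans)+
    \<comment> \<open>Changing one factor at a time splits the difference of products into two
      terms, each smaller than \<open>(z - b) * t\<close>.\<close>
    have "(y - b) * s - (z - b) * t = (y - b) * (s - t) + ((y - b) - (z - b)) * t"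
      by (simp add: algebra_simps)
    moreover have "absv ((y - b) * (s - t)) < absv (z - b) * absv t"
      unfolding absv_mult yb using IH pos by (intro mult_strict_left_mono)
    moreover have "absv (((y - b) - (z - b)) * t) < absv (z - b) * absv t"
      unfolding absv_mult using b pos by (intro mult_strict_right_mono)
    ultimately have "absv ((y - b) * s - (z - b) * t) < absv ((z - b) * t)"
      by (simp only: absv_mult absv_add_less)
    then show ?case by (simp add: s_def t_def)
  qed simp
  then have "absv (lead_coeff f) * absv ((\<Prod>b\<leftarrow>bs. y - b) - (\<Prod>b\<leftarrow>bs. z - b)) <
      absv (lead_coeff f) * absv (\<Prod>b\<leftarrow>bs. z - b)"
    using f(2) by (intro mult_strict_left_mono) auto
  moreover have "poly f w = lead_coeff f * (\<Prod>b\<leftarrow>bs. w - b)" for w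
    by (subst bs(2)) (simp add: poly_prod_roots)
  ultimately show ?thesis by (simp only: absv_mult flip: right_diff_distrib)
qed

lemma residue_adjoin:
  assumes y: "y \<in> adjoin E x" "absv y = 1"
  shows "\<exists>d\<in>E. absv (y - d) < 1"
proof -
  obtain g where g: "g \<in> polys_over E" "y = poly g x" using y(1) by (auto simp: adjoin_def)
  obtain f where f: "f \<in> polys_over E" "y = poly f x" "degree f < degree m"
    using E.minpoly_reduce[OF minimal_minpoly g(1)] g(2) by auto
  have f0: "f \<noteq> 0" using f(2) y(2) by auto
  obtain as where as: "set as \<subseteq> Qp_bar" "set as \<subseteq> D" "m = (\<Prod>a\<leftarrow>as. [:- a, 1:])"
    "length as = degree m" by (rule minpoly_splits)
  obtain k where k: "degree m = p ^ k" using degree_eq_prime_power by auto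
  have close: "absv (poly f a - y) < 1" if a: "a \<in> set as" for a
    using absv_poly_diff_less[OF f(1) f0 f(3) _ minimal_in(1), of a] a as(2) f(2) y(2) by auto
  \<comment> \<open>The product is the norm of \<open>y\<close>; each factor is congruent to
    \<open>y\<close>, which itself represents the residue.\<close>
  have "absv ((\<Prod>a\<leftarrow>as. poly f a) - y ^ length as) < 1"
    using close
  proof (induction as)
    case (Cons a as)
    define s where "s = (\<Prod>a\<leftarrow>as. poly f a)"
    have s: "absv (s - y ^ length as) < 1" using Cons by (simp add: s_def)
    have a: "absv (poly f a - y) < 1" using Cons.prems by simp
    have fa: "absv (poly f a) = 1" using absv_eq_if_close[of "poly f a" y] a y(2) by simp
    have "poly f a * s - y * y ^ length as =
        poly f a * (s - y ^ length as) + (poly f a - y) * y ^ length as"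
      by (simp add: algebra_simps)
    moreover have "absv (poly f a * (s - y ^ length as)) < 1" using s fa by (simp add: absv_mult)
    moreover have "absv ((poly f a - y) * y ^ length as) < 1"
      using a y(2) by (simp add: absv_mult absv_power)
    ultimately have "absv (poly f a * s - y * y ^ length as) < 1" by (simp only: absv_add_less)
    then show ?case by (simp add: s_def)
  qed simp
  then have "absv (y ^ (p ^ k) - (\<Prod>a\<leftarrow>as. poly f a)) < 1"
    by (subst absv_minus_commute) (simp add: as(4) k)
  moreover have "(\<Prod>a\<leftarrow>as. poly f a) \<in> E"
    by (rule Q.prod_values_at_roots_in_subfield[OF E.is_subfield E_subset_Qp_bar as(1) _ f(1)])
       (use minpolyD(1)[OF minimal_minpoly] as(3) in simp)
  ultimately show ?thesis
    using residue_field_perfect[OF E.is_subfield locally_compact_finite_extension[OF E]] y(2) by auto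
qed

lemma ramification_index_adjoin: "ramification_index E (adjoin E x) = degree m"
  using ext_degree_eq_ramification_index[OF locally_compact_finite_extension[OF E]
      E.finite_extension_adjoin(1)[OF minimal_minpoly] residue_adjoin] E.finite_extension_adjoin(2)[OF minimal_minpoly]
  by simp

lemma degree_le_ramification_index:
  assumes F: "is_finite_extension E F" "F \<inter> D \<noteq> {}"
  shows "degree m \<le> ramification_index E F"
proof -
  obtain y where y: "y \<in> F" "y \<in> D" using F(2) by auto
  interpret F: Cp_subfield F
    by (rule Cp_subfield.intro) (use F(1) in \<open>simp add: is_finite_extension_def\<close>)
  have EF: "E \<subseteq> F" using F(1) by (simp add: is_finite_extension_def)
  have "values_coset E ` (adjoin E x - {0}) \<subseteq> values_coset E ` (F - {0})"
  proof (rule image_subsetI)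
    fix z assume z: "z \<in> adjoin E x - {0}"
    then obtain g where g: "g \<in> polys_over E" "z = poly g x" by (auto simp: adjoin_def)
    obtain f where f: "f \<in> polys_over E" "z = poly f x" "degree f < degree m"
      using E.minpoly_reduce[OF minimal_minpoly g(1)] g(2) by auto
    have f0: "f \<noteq> 0" using f(2) z by auto
    have "absv (poly f y) = absv z"
      \<comment> \<open>Evaluating the same \<open>f\<close> at the point \<open>y\<close> of
        \<open>F\<close> instead of \<open>x\<close> produces an element of \<open>F\<close> with
        the value of \<open>z\<close>.\<close>
      unfolding f(2) by (rule absv_eq_if_close[OF absv_poly_diff_less[OF f(1) f0 f(3) y(2) minimal_in(1)]])
    moreover from this have "poly f y \<noteq> 0" using z by (metis Diff_iff absv_eq_0_iff singletonI)
    moreover have "poly f y \<in> F" using f(1) polys_over_mono[OF EF] y(1) by auto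
    ultimately show "values_coset E z \<in> values_coset E ` (F - {0})"
      by (intro image_eqI[of _ _ "poly f y"]) (auto simp: values_coset_def)
  qed
  then have "ramification_index E (adjoin E x) \<le> ramification_index E F"
    unfolding ramification_index_eq using ramification_index_le[OF F(1)] by (intro card_mono) auto
  then show ?thesis using ramification_index_adjoin by simp
qed

lemma finite_extension_adjoin_meets: "is_finite_extension E (adjoin E x)"
  "ext_degree E (adjoin E x) = degree m" "adjoin E x \<inter> D \<noteq> {}"
  using E.finite_extension_adjoin[OF minimal_minpoly] E.self_in_adjoin minimal_in(1) by auto

end

end

theorem theorem1p1:
  fixes p e :: nat and E D :: "'c::{field_char_0,complete_space} set"
  assumes "padic_complex TYPE('c) p"
    and "is_finite_extension Qp E"
    and "is_disk D"
    and "defined_over E D"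
    and "e = (LEAST n. \<exists>F. is_finite_extension E F \<and> ramification_index E F = n \<and> F \<inter> D \<noteq> {})"
  shows "\<exists>s::nat. e = p ^ s \<and>
    (\<exists>F. is_finite_extension E F \<and>
      real (ext_degree E F) \<le> max 1 (real p powi (2 * int s - 1)) \<and> F \<inter> D \<noteq> {}) \<and>
    (s \<le> 1 \<longrightarrow>
      (\<forall>F. is_finite_extension E F \<and>
        real (ext_degree E F) \<le> max 1 (real p powi (2 * int s - 1)) \<and> F \<inter> D \<noteq> {} \<longrightarrow>
        totally_ramified E F))"
proof -
  interpret padic_complex p by (rule assms(1))
  have sep: "separated D" by (rule disk_separated[OF assms(3)])
  obtain x m where min: "minimal_degree_point E D x m"
    using minimal_degree_point_exists[OF assms(2,3,4)] by blast
  note facts = assms(2) sep min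
  obtain s where s: "degree m = p ^ s" using degree_eq_prime_power[OF facts] by auto
  note L = finite_extension_adjoin_meets[OF facts]
  have e: "e = p ^ s"
    unfolding assms(5)
  proof (rule Least_equality)
    show "\<exists>F. is_finite_extension E F \<and> ramification_index E F = p ^ s \<and> F \<inter> D \<noteq> {}"
      using L ramification_index_adjoin[OF facts] s by auto
  qed (use degree_le_ramification_index[OF facts] s in auto)
  \<comment> \<open>For \<open>s = t + 1\<close> the exponent \<open>2 s - 1\<close> is
    \<open>s + t\<close>; for \<open>s = 0\<close> the degree 1 is covered by the maximum.\<close>
  have bound: "real (p ^ s) \<le> max 1 (real p powi (2 * int s - 1))"
  proof (cases s)
    case (Suc t)
    have "2 * int s - 1 = int (s + t)" using Suc by simp
    then have "real p powi (2 * int s - 1) = real p ^ (s + t)" by (simp only: power_int_of_nat)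
    moreover have "real p ^ s \<le> real p ^ (s + t)" using p_gt_1 by (intro power_increasing) auto
    ultimately show ?thesis by simp
  qed simp
  \<comment> \<open>For \<open>s = 0\<close> the power is \<open>1 / p\<close> and the maximum is 1;
    for \<open>s = 1\<close> the exponent is 1.\<close>
  have small: "max 1 (real p powi (2 * int s - 1)) = real (p ^ s)" if "s \<le> 1"
  proof (cases "s = 0")
    case True
    then show ?thesis using p_gt_1 by (simp add: power_int_minus field_simps)
  next
    case False
    then have "s = 1" using \<open>s \<le> 1\<close> by simp
    then show ?thesis using p_gt_1 by simp
  qed
  show ?thesis
  proof (intro exI[of _ s] conjI impI allI)
    show "e = p ^ s" by (rule e)
    show "\<exists>F. is_finite_extension E F \<and>
      real (ext_degree E F) \<le> max 1 (real p powi (2 * int s - 1)) \<and> F \<inter> D \<noteq> {}"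
      using L s bound by auto
    fix F assume "s \<le> 1" and F: "is_finite_extension E F \<and>
      real (ext_degree E F) \<le> max 1 (real p powi (2 * int s - 1)) \<and> F \<inter> D \<noteq> {}"
    \<comment> \<open>Now \<open>p ^ s\<close> is at most the ramification index, which is at most
      the degree, which is at most \<open>p ^ s\<close>.\<close>
    then have "ext_degree E F \<le> p ^ s" using small by (simp only: of_nat_le_iff)
    then show "totally_ramified E F"
      using degree_le_ramification_index[OF facts] ramification_index_le[of E F] F s
      unfolding totally_ramified_def by fastforce
  qed
qed

end
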